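(* There exist absolute constants $0<c<C$ such that for all $\varepsilon\in(0,1)$ and all $n\ge C/\varepsilon$: 1. For every local property $\mathcal{P}$ of sequences $f:[n]\to\mathbb{R}$ and every $t\le c\varepsilon$, there exists an $\varepsilon$-tester for $\mathcal{P}$ that works in the presence of a $t$-online erasure budget-managing adversary (with batch size 1) and makes $O\left(\frac{\log(\varepsilon n)}{\varepsilon}\right)$ queries. 2. For every $t\ge C\varepsilon$, there is no $\varepsilon$-tester for sortedness of sequences $f:[n]\to\mathbb{R}$ that works in the presence of a $t$-online erasure budget-managing adversary (with batch size 1), with any number of queries. Both of these results hold (with the same parameters) if erasures are replaced with corruptions. In the case of an erasure adversary, the tester has one-sided error.
   Context: $\log$ is base 2; $[n]=\{1,\dots,n\}$; $t$ is a positive real. A property $\mathcal{P}$ of sequences $f:[n]\to\mathbb{R}$ is local if there is a family $\mathcal{F}\subseteq\mathbb{R}^2$ of forbidden pairs such that $f\in\mathcal{P}$ iff $(f(i),f(i+1))\notin\mathcal{F}$ for all $i\in[n-1]$. Sortedness is the property $f(x)\le f(y)$ for all $x<y$. Online model. Access to the input $f$ is via a sequence of oracles $\mathcal{O}_1,\mathcal{O}_2,\dots$, where $\mathcal{O}_i$ answers the $i$-th query (batch size 1) and $\mathcal{O}_1=f$. After each query the adversary chooses the next oracle; its strategy may depend on the input, the tester's description, and all queries made so far, but not on the tester's future coin tosses. Let $\mathrm{Dist}$ denote Hamming distance (number of points with different answers). A $t$-online budget-managing adversary must satisfy $\mathrm{Dist}(\mathcal{O}_1,\mathcal{O}_{i+1})\le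 i\cdot t$ for all $i\in\mathbb{N}$. An erasure adversary must satisfy $\mathcal{O}_{i+1}(x)\in\{\mathcal{O}_i(x),\perp\}$ for all $x$ ($\perp$ is the erasure symbol); a corruption adversary may change values arbitrarily within the range. $f$ is $\varepsilon$-far from $\mathcal{P}$ if at least an $\varepsilon$ fraction of the values of $f$ must be changed to obtain a sequence in $\mathcal{P}$. An (online) $\varepsilon$-tester for $\mathcal{P}$ working in the presence of a given type of adversary is a randomized algorithm that, for every adversarial strategy of that type, accepts with probability at least $2/3$ if $f\in\mathcal{P}$ and rejects with probability at least $2/3$ if $f$ is $\varepsilon$-far from $\mathcal{P}$. It has one-sided error if it always accepts every $f\in\mathcal{P}$.
   Formalization: Part 2 is proved for ε ≤ 1−δ, for any δ in (0,1), with C depending on δ (c and the O-constant stay absolute). As stated it fails near ε = 1: for 1−1/n < ε < 1 no sequence is ε-far from sorted, so always accepting is a tester. Part 1 covers all ε in (0,1). *)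

theory Defs
  imports "HOL-Probability.Probability"
begin

text \<open>A sequence $f : [n] \to \mathbb{R}$ is a function on \<^typ>\<open>nat\<close> of which only the values
  on \<open>{1..n}\<close> matter; a property of such sequences is a set of functions.\<close>

definition local_property :: "nat \<Rightarrow> (nat \<Rightarrow> real) set \<Rightarrow> bool" where
  "local_property n P \<longleftrightarrow>
     (\<exists>F :: (real \<times> real) set. \<forall>f. f \<in> P \<longleftrightarrow> (\<forall>i\<in>{1..n - 1}. (f i, f (i + 1)) \<notin> F))"

definition sortedness :: "nat \<Rightarrow> (nat \<Rightarrow> real) set" where
  "sortedness n = {f. \<forall>x\<in>{1..n}. \<forall>y\<in>{1..n}. x < y \<longrightarrow> f x \<le> f y}"

definition Dist :: "nat \<Rightarrow> (nat \<Rightarrow> 'a) \<Rightarrow> (nat \<Rightarrow> 'a) \<Rightarrow> nat" where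
  "Dist n g h = card {x \<in> {1..n}. g x \<noteq> h x}"

definition eps_far :: "nat \<Rightarrow> real \<Rightarrow> (nat \<Rightarrow> real) set \<Rightarrow> (nat \<Rightarrow> real) \<Rightarrow> bool" where
  "eps_far n \<epsilon> P f \<longleftrightarrow> (\<forall>g\<in>P. \<epsilon> * real n \<le> real (Dist n f g))"

text \<open>The oracles answer in \<^typ>\<open>real option\<close>; \<^const>\<open>None\<close> stands for the erasure symbol.\<close>

type_synonym oracle_fun = "nat \<Rightarrow> real option"

text \<open>A strategy maps the queries \<open>[x\<^sub>1, \<dots>, x\<^sub>i]\<close> made so far to the function
  \<open>\<O>\<^sub>i\<^sub>+\<^sub>1\<close> that answers the next query. Past answers are determined by the
  strategy and the queries, so they need not be arguments; dependence on the input and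
  on the tester's description comes from quantifying over the strategy after both.\<close>

type_synonym strategy = "nat list \<Rightarrow> oracle_fun"

definition initial_input :: "nat \<Rightarrow> (nat \<Rightarrow> real) \<Rightarrow> strategy \<Rightarrow> bool" where
  "initial_input n f A \<longleftrightarrow> (\<forall>x\<in>{1..n}. A [] x = Some (f x))"

definition budget_managing :: "nat \<Rightarrow> real \<Rightarrow> strategy \<Rightarrow> bool" where
  "budget_managing n t A \<longleftrightarrow> (\<forall>xs. real (Dist n (A []) (A xs)) \<le> real (length xs) * t)"

definition erasing :: "nat \<Rightarrow> strategy \<Rightarrow> bool" where
  "erasing n A \<longleftrightarrow> (\<forall>xs y. \<forall>x\<in>{1..n}. A (xs @ [y]) x \<in> {A xs x, None})"

definition corrupting :: "nat \<Rightarrow> strategy \<Rightarrow> bool" where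
  "corrupting n A \<longleftrightarrow> (\<forall>xs. \<forall>x\<in>{1..n}. A xs x \<noteq> None)"

definition erasure_adversary :: "nat \<Rightarrow> real \<Rightarrow> (nat \<Rightarrow> real) \<Rightarrow> strategy \<Rightarrow> bool" where
  "erasure_adversary n t f A \<longleftrightarrow> initial_input n f A \<and> budget_managing n t A \<and> erasing n A"

definition corruption_adversary :: "nat \<Rightarrow> real \<Rightarrow> (nat \<Rightarrow> real) \<Rightarrow> strategy \<Rightarrow> bool" where
  "corruption_adversary n t f A \<longleftrightarrow> initial_input n f A \<and> budget_managing n t A \<and> corrupting n A"

datatype action = Query nat | Accept | Reject

text \<open>Before each action the tester tosses coins, whose outcome is a natural number with an
  arbitrary discrete distribution. The tester remembers its coins, queries and the answers; the
  adversary sees the queries only.\<close>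

type_synonym history = "(nat \<times> nat \<times> real option) list"
type_synonym tester = "history \<Rightarrow> (nat \<times> action) pmf"

definition queries :: "history \<Rightarrow> nat list" where
  "queries h = map (\<lambda>(r, x, a). x) h"

definition queries_in :: "nat \<Rightarrow> tester \<Rightarrow> bool" where
  "queries_in n T \<longleftrightarrow> (\<forall>h r x. (r, Query x) \<in> set_pmf (T h) \<longrightarrow> x \<in> {1..n})"

definition makes_at_most_queries :: "nat \<Rightarrow> tester \<Rightarrow> bool" where
  "makes_at_most_queries q T \<longleftrightarrow> (\<forall>h r x. q \<le> length h \<longrightarrow> (r, Query x) \<notin> set_pmf (T h))"

text \<open>The verdict (\<^term>\<open>Some True\<close> for acceptance) if it is reached within \<open>k\<close> further actions
  after history \<open>h\<close>, and \<^const>\<open>None\<close> otherwise.\<close>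

primrec run :: "tester \<Rightarrow> strategy \<Rightarrow> nat \<Rightarrow> history \<Rightarrow> bool option pmf" where
  "run T A 0 h = return_pmf None"
| "run T A (Suc k) h = bind_pmf (T h) (\<lambda>(r, b). case b of
       Accept \<Rightarrow> return_pmf (Some True)
     | Reject \<Rightarrow> return_pmf (Some False)
     | Query x \<Rightarrow> run T A k (h @ [(r, x, A (queries h) x)]))"

text \<open>The number of queries need not be bounded, hence the limit of an increasing sequence.\<close>

definition verdict_prob :: "tester \<Rightarrow> strategy \<Rightarrow> bool \<Rightarrow> real" where
  "verdict_prob T A v = (SUP k. pmf (run T A k []) (Some v))"

definition eps_tester ::
  "nat \<Rightarrow> real \<Rightarrow> (nat \<Rightarrow> real) set \<Rightarrow> ((nat \<Rightarrow> real) \<Rightarrow> strategy \<Rightarrow> bool) \<Rightarrow> tester \<Rightarrow> bool" where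
  "eps_tester n \<epsilon> P adv T \<longleftrightarrow> queries_in n T \<and>
     (\<forall>f A. adv f A \<longrightarrow>
        (f \<in> P \<longrightarrow> verdict_prob T A True \<ge> 2 / 3) \<and>
        (eps_far n \<epsilon> P f \<longrightarrow> verdict_prob T A False \<ge> 2 / 3))"

definition one_sided ::
  "(nat \<Rightarrow> real) set \<Rightarrow> ((nat \<Rightarrow> real) \<Rightarrow> strategy \<Rightarrow> bool) \<Rightarrow> tester \<Rightarrow> bool" where
  "one_sided P adv T \<longleftrightarrow> (\<forall>f\<in>P. \<forall>A. adv f A \<longrightarrow> verdict_prob T A True = 1)"

end

theory Submission
  imports Defs
begin

text \<open>Upper bound. Call \<open>a\<close> and \<open>b\<close> in conflict if no member of the
  property agrees with the input at both. If the input is far, the number of conflicting pairs of the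
  form \<open>(a, a + 2 ^ j)\<close> with \<open>2 ^ j \<le> \<epsilon> n / 4\<close> is at least
  of order \<open>\<epsilon> n\<close>. The tester first queries many uniform points
  \<open>a\<close> and only then uniform points among all \<open>a + 2 ^ j\<close>. At any moment
  the adversary knows little about the next query, so with constant probability no query ever meets an
  altered point, while some conflicting pair is found. Keeping the two phases apart matters because a
  corruption adversary may take back its changes: if \<open>a + 2 ^ j\<close> were queried right after
  \<open>a\<close>, a budget of a single point could suffice to hide a conflict.

  Lower bound. Cut \<open>{1..n}\<close> into blocks of constant length, of which a random fraction of
  order \<open>\<epsilon>\<close> is special. A special block is constant in the sorted input and a
  cyclic shift of a decreasing sequence in the far one, so a single query to it reveals nothing. After
  that query the adversary hides the rest of the block. A tester touches special blocks at rate
  \<open>O(\<epsilon>)\<close>, so for \<open>t \<ge> C \<epsilon>\<close> the budget suffices at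
  all times with high probability, whatever the number of queries.\<close>

section \<open>Conflicts in far sequences\<close>

text \<open>The query count comes from a balance. With \<open>\<Lambda>\<close> scales and about
  \<open>\<epsilon> * n\<close> conflicting pairs over \<open>n\<close> left ends, \<open>m\<close>
  of order \<open>\<Lambda> / \<epsilon>\<close> first-phase points have about
  \<open>\<Lambda>\<close> conflicting successors. The second phase draws \<open>m\<close> times
  from a set of \<open>m * \<Lambda>\<close> points and so expects a constant number of hits. The
  adversary has altered about \<open>m * t\<close> points by then, a small multiple of
  \<open>\<Lambda>\<close>; even if all of them lie in that set, a hit is unlikely. The obstacle is
  that conflicting pairs may share right ends, so the successors must be counted as a set. Each
  point is a right end at most once per scale, so few collected successors exhaust few pairs.

  In the lower bound, averaging over the secrets is done for an ideal oracle that ignores the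
  budget; the real adversary departs from it only after overspending. The chance of ever
  overspending is at most the initial value of an exponential supermartingale, which does not grow
  with the number of queries.\<close>

definition conflict :: "(nat \<Rightarrow> real) set \<Rightarrow> (nat \<Rightarrow> real) \<Rightarrow> nat \<Rightarrow> nat \<Rightarrow> bool" where
  "conflict P f a b \<longleftrightarrow> \<not> (\<exists>g\<in>P. g a = f a \<and> g b = f b)"

text \<open>Every adjacent pair lies on one side of \<open>p\<close>; for \<open>i = p\<close> the
  common value lets \<open>h\<close> take over. Locality of \<open>P\<close> enters only
  here.\<close>

lemma local_property_glue:
  assumes "local_property n P" "g \<in> P" "h \<in> P" "g p = h p"
  shows "(\<lambda>x. if x \<le> p then g x else h x) \<in> P"
proof -
  obtain F where F: "\<And>f. f \<in> P \<longleftrightarrow> (\<forall>i\<in>{1..n - 1}. (f i, f (i + 1)) \<notin> F)"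
    using assms(1) unfolding local_property_def by blast
  show ?thesis
    unfolding F
  proof
    fix i assume i: "i \<in> {1..n - 1}"
    have "(g i, g (i + 1)) \<notin> F" "(h i, h (i + 1)) \<notin> F"
      using assms(2,3) i F by blast+
    then show "(if i \<le> p then g i else h i, if i + 1 \<le> p then g (i + 1) else h (i + 1)) \<notin> F"
      using assms(4) by (cases "i = p") auto
  qed
qed

text \<open>The total length of the intervals on which \<open>B\<close> holds in the dyadic tree of depth \<open>l\<close> over
  \<open>[a, a + 2 ^ l]\<close>. It bounds the cost of a repair: every interval with a conflict lies in a
  conflict-free one of twice its length, which can be refilled, or in a conflicting root.\<close>

primrec dyadic_badness :: "(nat \<Rightarrow> nat \<Rightarrow> bool) \<Rightarrow> nat \<Rightarrow> nat \<Rightarrow> nat" where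
  "dyadic_badness B 0 a = of_bool (B a (a + 1))"
| "dyadic_badness B (Suc l) a =
     2 ^ Suc l * of_bool (B a (a + 2 ^ Suc l)) + dyadic_badness B l a + dyadic_badness B l (a + 2 ^ l)"

lemma dyadic_badness_ge: "B a (a + 2 ^ l) \<Longrightarrow> 2 ^ l \<le> dyadic_badness B l a"
  by (cases l) auto

lemma card_glue_le:
  fixes f g h :: "nat \<Rightarrow> real"
  assumes "card {x\<in>{a..p}. g x \<noteq> f x} \<le> u" "card {x\<in>{p..b}. h x \<noteq> f x} \<le> v"
  shows "card {x\<in>{a..b}. (if x \<le> p then g x else h x) \<noteq> f x} \<le> u + v"
proof -
  have "card {x\<in>{a..b}. (if x \<le> p then g x else h x) \<noteq> f x}
      \<le> card ({x\<in>{a..p}. g x \<noteq> f x} \<union> {x\<in>{p..b}. h x \<noteq> f x})"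
    by (intro card_mono) auto
  also have "\<dots> \<le> card {x\<in>{a..p}. g x \<noteq> f x} + card {x\<in>{p..b}. h x \<noteq> f x}"
    by (rule card_Un_le)
  finally show ?thesis using assms by linarith
qed

text \<open>Both end values are kept so that neighbouring repairs can be glued. If a half is in
  conflict, the whole interval is refilled and charged to that half, which has half its length;
  hence the factor 2.\<close>

lemma repair_dyadic_interval:
  assumes "local_property n P" "\<not> conflict P f a (a + 2 ^ l)"
  shows "\<exists>g\<in>P. g a = f a \<and> g (a + 2 ^ l) = f (a + 2 ^ l) \<and>
    card {x\<in>{a..a + 2 ^ l}. g x \<noteq> f x} \<le> 2 * dyadic_badness (conflict P f) l a"
  using assms(2)
proof (induction l arbitrary: a)
  case 0
  then obtain g where g: "g \<in> P" "g a = f a" "g (a + 1) = f (a + 1)"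
    unfolding conflict_def by auto
  have "x = a \<or> x = a + 1" if "x \<in> {a..a + 2 ^ 0}" for x
    using that by auto
  then have "{x\<in>{a..a + 2 ^ 0}. g x \<noteq> f x} = {}"
    using g by blast
  then have "card {x\<in>{a..a + 2 ^ 0}. g x \<noteq> f x} \<le> 2 * dyadic_badness (conflict P f) 0 a"
    by (simp only: card.empty zero_le)
  then show ?case using g by (intro bexI[OF _ g(1)] conjI) simp_all
next
  case (Suc l)
  let ?p = "a + 2 ^ l" and ?b = "a + 2 ^ Suc l"
  have b: "?p + 2 ^ l = ?b" by simp
  show ?case
  proof (cases "conflict P f a ?p \<or> conflict P f ?p ?b")
    case True
    then have "2 ^ l \<le> dyadic_badness (conflict P f) (Suc l) a"
      using dyadic_badness_ge[of "conflict P f" a l] dyadic_badness_ge[of "conflict P f" ?p l]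
      unfolding b by auto
    moreover obtain g where g: "g \<in> P" "g a = f a" "g ?b = f ?b"
      using Suc.prems unfolding conflict_def by blast
    \<comment> \<open>The interval has \<open>2 ^ Suc l + 1\<close> points; leaving out
      \<open>a\<close>, where nothing changes, gives exactly twice \<open>2 ^ l\<close>.\<close>
    moreover have "card {x\<in>{a..?b}. g x \<noteq> f x} \<le> card {a<..?b}"
      using g by (intro card_mono) (auto simp: le_less)
    ultimately show ?thesis
      by (intro bexI[of _ g]) auto
  next
    case False
    obtain g where g: "g \<in> P" "g a = f a" "g ?p = f ?p"
      "card {x\<in>{a..?p}. g x \<noteq> f x} \<le> 2 * dyadic_badness (conflict P f) l a"
      using Suc.IH[of a] False by auto
    obtain h where h: "h \<in> P" "h ?p = f ?p" "h ?b = f ?b"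
      "card {x\<in>{?p..?b}. h x \<noteq> f x} \<le> 2 * dyadic_badness (conflict P f) l ?p"
      using Suc.IH[of ?p] False unfolding b by auto
    let ?k = "\<lambda>x. if x \<le> ?p then g x else h x"
    have "?k \<in> P"
      using local_property_glue[OF assms(1) g(1) h(1)] g h by simp
    moreover have "card {x\<in>{a..?b}. ?k x \<noteq> f x} \<le> 2 * dyadic_badness (conflict P f) (Suc l) a"
      using card_glue_le[OF g(4) h(4)] by simp
    ultimately show ?thesis
      using g h by (intro bexI[of _ ?k]) auto
  qed
qed

lemma repair_dyadic_chain:
  assumes "local_property n P"
    and "\<And>i. i \<le> r \<Longrightarrow> \<not> conflict P f (s + i * 2 ^ l) (s + i * 2 ^ l + 2 ^ l)"
  shows "\<exists>g\<in>P. g (s + Suc r * 2 ^ l) = f (s + Suc r * 2 ^ l) \<and>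
    card {x\<in>{s..s + Suc r * 2 ^ l}. g x \<noteq> f x}
      \<le> 2 * (\<Sum>i\<le>r. dyadic_badness (conflict P f) l (s + i * 2 ^ l))"
  using assms(2)
proof (induction r)
  case 0
  then show ?case using repair_dyadic_interval[OF assms(1), of f s l] by auto
next
  case (Suc r)
  let ?p = "s + Suc r * 2 ^ l"
  have b: "s + Suc (Suc r) * 2 ^ l = ?p + 2 ^ l" by simp
  obtain g where g: "g \<in> P" "g ?p = f ?p"
    "card {x\<in>{s..?p}. g x \<noteq> f x} \<le> 2 * (\<Sum>i\<le>r. dyadic_badness (conflict P f) l (s + i * 2 ^ l))"
    using Suc.IH Suc.prems by auto
  obtain h where h: "h \<in> P" "h ?p = f ?p" "h (?p + 2 ^ l) = f (?p + 2 ^ l)"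
    "card {x\<in>{?p..?p + 2 ^ l}. h x \<noteq> f x} \<le> 2 * dyadic_badness (conflict P f) l ?p"
    using repair_dyadic_interval[OF assms(1)] Suc.prems[of "Suc r"] by blast
  let ?k = "\<lambda>x. if x \<le> ?p then g x else h x"
  have "?k \<in> P"
    using local_property_glue[OF assms(1) g(1) h(1)] g h by simp
  moreover have "card {x\<in>{s..?p + 2 ^ l}. ?k x \<noteq> f x}
     \<le> 2 * (\<Sum>i\<le>Suc r. dyadic_badness (conflict P f) l (s + i * 2 ^ l))"
    using card_glue_le[OF g(3) h(4)] by simp
  ultimately show ?case
    unfolding b using g h by (intro bexI[of _ ?k]) auto
qed

text \<open>An interval of length \<open>2 ^ j\<close> is a node of at most
  \<open>2 ^ (l - j)\<close> of the trees and has weight \<open>2 ^ j\<close> in each, so every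
  conflict counts at most \<open>2 ^ l\<close> times, whatever its scale.\<close>

lemma sum_dyadic_badness_le:
  "(\<Sum>a\<in>{1..n - 2 ^ l}. dyadic_badness B l a)
     \<le> 2 ^ l * (\<Sum>j\<le>l. card {a\<in>{1..n - 2 ^ j}. B a (a + 2 ^ j)})"
proof (induction l)
  case 0
  then show ?case by (simp add: Int_def conj_commute)
next
  case (Suc l)
  let ?U = "\<lambda>j. card {a\<in>{1..n - 2 ^ j}. B a (a + 2 ^ j)}" and ?I = "{1..n - 2 ^ Suc l}"
  have "(\<Sum>a\<in>?I. dyadic_badness B l a) \<le> (\<Sum>a\<in>{1..n - 2 ^ l}. dyadic_badness B l a)"
    by (rule sum_mono2) auto
  moreover have "(\<Sum>a\<in>?I. dyadic_badness B l (a + 2 ^ l)) = sum (dyadic_badness B l) ((\<lambda>a. a + 2 ^ l) ` ?I)"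
    by (subst sum.reindex) auto
  moreover have "\<dots> \<le> sum (dyadic_badness B l) {1..n - 2 ^ l}"
    by (rule sum_mono2) auto
  moreover have "(\<Sum>a\<in>?I. dyadic_badness B (Suc l) a) = 2 ^ Suc l * ?U (Suc l)
      + (\<Sum>a\<in>?I. dyadic_badness B l a) + (\<Sum>a\<in>?I. dyadic_badness B l (a + 2 ^ l))"
    by (simp add: sum.distrib sum_distrib_left[symmetric] Int_def conj_commute)
  ultimately show ?case
    using Suc by (simp add: algebra_simps)
qed

text \<open>The idea is to average over the \<open>2 ^ L\<close> translates of the dyadic grid. If there are few conflicts, then in some
  translate the conflicting intervals have total length below \<open>2 ^ L\<close>, so no top-level interval is
  among them, and the repairs of the top-level intervals fit together. The two ends outside the
  grid need no care since \<^const>\<open>conflict\<close> refers to sequences on the whole of \<open>{1..n}\<close>.\<close>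

lemma eps_far_many_conflicts:
  assumes P: "local_property n P" and far: "eps_far n \<epsilon> P f"
    and n: "2 * 2 ^ L \<le> n" and L: "4 * 2 ^ L \<le> \<epsilon> * real n"
  shows "2 ^ L \<le> (\<Sum>j\<le>L. card {a\<in>{1..n - 2 ^ j}. conflict P f a (a + 2 ^ j)})"
proof (rule ccontr)
  define \<beta> where "\<beta> = dyadic_badness (conflict P f) L"
  define r where "r s = (n - s) div 2 ^ L" for s
  assume "\<not> ?thesis"
  then have lt: "(\<Sum>a\<in>{1..n - 2 ^ L}. \<beta> a) < 2 ^ L * 2 ^ L"
    using le_less_trans[OF sum_dyadic_badness_le[of "conflict P f" L n]]
    unfolding \<beta>_def not_le by simp
  have r: "s + r s * 2 ^ L \<le> n" "n < s + r s * 2 ^ L + 2 ^ L" "1 \<le> r s" if "s \<in> {1..2 ^ L}" for s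
  proof -
    have *: "n - s = r s * 2 ^ L + (n - s) mod 2 ^ L"
      unfolding r_def by (rule div_mult_mod_eq[symmetric])
    have "(n - s) mod 2 ^ L < 2 ^ L" "s \<le> 2 ^ L" using that by auto
    then show "s + r s * 2 ^ L \<le> n" "n < s + r s * 2 ^ L + 2 ^ L"
      using * n by linarith+
    have "2 ^ L div 2 ^ L \<le> (n - s) div 2 ^ L"
      using that n by (intro div_le_mono) auto
    then show "1 \<le> r s" unfolding r_def by simp
  qed
  let ?A = "Sigma {1..2 ^ L} (\<lambda>s. {..<r s})" and ?h = "\<lambda>(s, i). s + i * 2 ^ L"
  \<comment> \<open>A start position determines its translate \<open>s\<close>, as a residue modulo
    \<open>2 ^ L\<close>, so the trees of all translates are distinct members of the sum bounded in
    \<open>lt\<close>.\<close>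
  have inj: "inj_on ?h ?A"
  proof (rule inj_onI, clarsimp)
    fix s i s' i' :: nat
    assume s: "Suc 0 \<le> s" "s \<le> 2 ^ L" "Suc 0 \<le> s'" "s' \<le> 2 ^ L"
      and eq: "s + i * 2 ^ L = s' + i' * 2 ^ L"
    have *: "(s - 1) + i * 2 ^ L = (s' - 1) + i' * 2 ^ L" using s eq by linarith
    have d: "(c + k * 2 ^ L) div 2 ^ L = k" if "c < 2 ^ L" for c k :: nat
      using that by simp
    have "s - 1 < 2 ^ L" "s' - 1 < 2 ^ L" using s by linarith+
    from d[OF this(1), of i] d[OF this(2), of i'] have "i = i'"
      unfolding * by simp
    then show "s = s' \<and> i = i'" using eq by simp
  qed
  have sub: "?h ` ?A \<subseteq> {1..n - 2 ^ L}"
  proof clarsimp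
    fix s i assume s: "Suc 0 \<le> s" "s \<le> 2 ^ L" and i: "i < r s"
    have "Suc i * 2 ^ L \<le> r s * 2 ^ L" using i by (intro mult_le_mono) auto
    then show "s + i * 2 ^ L \<le> n - 2 ^ L" using r(1)[of s] s by simp
  qed
  have "(\<Sum>s\<in>{1..2 ^ L}. \<Sum>i<r s. \<beta> (s + i * 2 ^ L)) = (\<Sum>x\<in>?A. \<beta> (?h x))"
    by (subst sum.Sigma) (auto simp: case_prod_beta)
  also have "\<dots> = sum \<beta> (?h ` ?A)" by (rule sum.reindex[OF inj, unfolded comp_def, symmetric])
  also have "\<dots> \<le> sum \<beta> {1..n - 2 ^ L}" by (rule sum_mono2[OF _ sub]) auto
  also note lt
  finally have total: "(\<Sum>s\<in>{1..2 ^ L}. \<Sum>i<r s. \<beta> (s + i * 2 ^ L)) < 2 ^ L * 2 ^ L" .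
  have "\<exists>s\<in>{1..2 ^ L}. (\<Sum>i<r s. \<beta> (s + i * 2 ^ L)) < 2 ^ L"
  proof (rule ccontr)
    assume "\<not> ?thesis"
    then have "(\<Sum>s\<in>{1..2 ^ L::nat}. 2 ^ L) \<le> (\<Sum>s\<in>{1..2 ^ L}. \<Sum>i<r s. \<beta> (s + i * 2 ^ L))"
      by (intro sum_mono) (meson not_le)
    with total show False by simp
  qed
  then obtain s where s: "s \<in> {1..2 ^ L}" and sm: "(\<Sum>i<r s. \<beta> (s + i * 2 ^ L)) < 2 ^ L"
    by blast
  have nc: "\<not> conflict P f (s + i * 2 ^ L) (s + i * 2 ^ L + 2 ^ L)" if "i < r s" for i
  proof
    assume "conflict P f (s + i * 2 ^ L) (s + i * 2 ^ L + 2 ^ L)"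
    then have "2 ^ L \<le> \<beta> (s + i * 2 ^ L)"
      unfolding \<beta>_def by (rule dyadic_badness_ge)
    also have "\<dots> \<le> (\<Sum>i<r s. \<beta> (s + i * 2 ^ L))"
      using that by (intro member_le_sum) auto
    finally show False using sm by simp
  qed
  obtain r' where r': "r s = Suc r'" using r(3)[OF s] by (cases "r s") auto
  let ?e = "s + r s * 2 ^ L"
  obtain g where g: "g \<in> P"
    "card {x\<in>{s..?e}. g x \<noteq> f x} \<le> 2 * (\<Sum>i\<le>r'. \<beta> (s + i * 2 ^ L))"
    using repair_dyadic_chain[OF P, of r' f s L] nc unfolding r' \<beta>_def less_Suc_eq_le by blast
  have "Dist n f g \<le> card ({1..<s} \<union> {x\<in>{s..?e}. g x \<noteq> f x} \<union> {?e<..n})"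
    unfolding Dist_def by (intro card_mono) auto
  also have "\<dots> \<le> card {1..<s} + card {x\<in>{s..?e}. g x \<noteq> f x} + card {?e<..n}"
    by (intro order_trans[OF card_Un_le] add_mono card_Un_le order_refl)
  \<comment> \<open>The two ends outside the grid cost less than \<open>2 ^ L\<close> each and the
    repairs less than \<open>2 * 2 ^ L\<close>; hence the factor 4 in the hypothesis on
    \<open>\<epsilon> * real n\<close>.\<close>
  also have "\<dots> < 4 * 2 ^ L"
  proof -
    have "card {x\<in>{s..?e}. g x \<noteq> f x} < 2 * 2 ^ L"
      using g(2) sm unfolding r' lessThan_Suc_atMost by linarith
    moreover have "card {1..<s} < 2 ^ L" "card {?e<..n} < 2 ^ L"
      using s r[OF s] by auto
    ultimately show ?thesis by linarith
  qed
  finally have "real (Dist n f g) < 4 * 2 ^ L"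
    by (metis of_nat_less_iff of_nat_mult of_nat_numeral of_nat_power)
  moreover have "\<epsilon> * real n \<le> real (Dist n f g)"
    using far g(1) unfolding eps_far_def by blast
  ultimately show False using L by linarith
qed

section \<open>Sampling testers\<close>

primrec extend_pmf :: "(nat list \<Rightarrow> nat set) \<Rightarrow> nat \<Rightarrow> nat list \<Rightarrow> nat list pmf" where
  "extend_pmf S 0 xs = return_pmf xs"
| "extend_pmf S (Suc k) xs = bind_pmf (pmf_of_set (S xs)) (\<lambda>x. extend_pmf S k (xs @ [x]))"

text \<open>The sets \<open>S\<close> depend on past queries but never on answers, so the query list
  has the law \<open>extend_pmf\<close> against every adversary. The recorded coin is always 0: the
  queries are the only randomness.\<close>

definition sampling_tester :: "nat \<Rightarrow> (nat list \<Rightarrow> nat set) \<Rightarrow> (history \<Rightarrow> bool) \<Rightarrow> tester" where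
  "sampling_tester q S V h =
     (if length h < q then map_pmf (\<lambda>x. (0, Query x)) (pmf_of_set (S (queries h)))
      else return_pmf (0, if V h then Accept else Reject))"

definition transcript :: "strategy \<Rightarrow> nat list \<Rightarrow> history" where
  "transcript A xs = map (\<lambda>i. (0, xs ! i, A (take i xs) (xs ! i))) [0..<length xs]"

lemma length_transcript [simp]: "length (transcript A xs) = length xs"
  by (simp add: transcript_def)

lemma queries_transcript [simp]: "queries (transcript A xs) = xs"
  by (simp add: transcript_def queries_def map_nth comp_def)

lemma transcript_Nil [simp]: "transcript A [] = []"
  by (simp add: transcript_def)

lemma transcript_snoc: "transcript A (xs @ [x]) = transcript A xs @ [(0, x, A xs x)]"
  by (simp add: transcript_def nth_append)

lemma set_transcript:
  "set (transcript A xs) = (\<lambda>i. (0, xs ! i, A (take i xs) (xs ! i))) ` {..<length xs}"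
  by (auto simp: transcript_def)

lemma run_sampling_tester:
  assumes "length xs + k = q"
  shows "run (sampling_tester q S V) A (Suc k) (transcript A xs)
    = map_pmf (\<lambda>ys. Some (V (transcript A ys))) (extend_pmf S k xs)"
  using assms
proof (induction k arbitrary: xs)
  case 0
  then show ?case by (simp add: sampling_tester_def bind_return_pmf)
next
  case (Suc k)
  have "run (sampling_tester q S V) A (Suc (Suc k)) (transcript A xs)
    = bind_pmf (pmf_of_set (S xs)) (\<lambda>x. run (sampling_tester q S V) A (Suc k) (transcript A (xs @ [x])))"
    using Suc.prems
    by (subst run.simps(2)) (simp add: sampling_tester_def bind_map_pmf transcript_snoc del: run.simps)
  also have "\<dots> = bind_pmf (pmf_of_set (S xs))
      (\<lambda>x. map_pmf (\<lambda>ys. Some (V (transcript A ys))) (extend_pmf S k (xs @ [x])))"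
    using Suc.prems by (intro bind_pmf_cong refl Suc.IH) auto
  finally show ?case by (simp add: map_bind_pmf)
qed

lemma bdd_above_pmf: "bdd_above (range (\<lambda>k. pmf (f k) x))"
  by (rule bdd_aboveI[of _ 1]) (auto intro: pmf_le_1)

lemma verdict_prob_sampling_tester:
  "measure_pmf.prob (extend_pmf S q []) {xs. V (transcript A xs) = v}
     \<le> verdict_prob (sampling_tester q S V) A v"
proof -
  have "measure_pmf.prob (extend_pmf S q []) {xs. V (transcript A xs) = v}
      = pmf (run (sampling_tester q S V) A (Suc q) []) (Some v)"
    using run_sampling_tester[of "[]" q q S V A] by (simp add: pmf_map vimage_def del: run.simps)
  also have "\<dots> \<le> verdict_prob (sampling_tester q S V) A v"
    unfolding verdict_prob_def by (rule cSUP_upper[OF _ bdd_above_pmf]) simp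
  finally show ?thesis .
qed

lemma verdict_prob_le_1: "verdict_prob T A v \<le> 1"
  unfolding verdict_prob_def by (rule cSUP_least) (auto intro: pmf_le_1)

section \<open>Supermartingale bounds for random query lists\<close>

lemma prob_bind_pmf_of_set:
  assumes "finite S" "S \<noteq> {}"
  shows "measure_pmf.prob (bind_pmf (pmf_of_set S) p) {x. E x}
    = (\<Sum>x\<in>S. measure_pmf.prob (p x) {x. E x}) / real (card S)"
proof -
  have *: "measure_pmf.prob p {x. E x} = pmf (map_pmf E p) True" for p
    by (simp add: pmf_map vimage_def)
  show ?thesis
    unfolding * map_bind_pmf using assms by (simp add: pmf_bind integral_pmf_of_set)
qed

text \<open>\<open>\<Phi>\<close> is a supermartingale along the query list that dominates the
  indicator of \<open>E\<close> at the end, so its current value bounds the probability.\<close>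

lemma prob_extend_pmf_le:
  fixes \<Phi> :: "nat list \<Rightarrow> real"
  assumes step: "\<And>xs. length xs < q \<Longrightarrow> finite (S xs) \<and> S xs \<noteq> {} \<and>
      (\<Sum>x\<in>S xs. \<Phi> (xs @ [x])) \<le> real (card (S xs)) * \<Phi> xs"
    and final: "\<And>xs. length xs = q \<Longrightarrow> of_bool (E xs) \<le> \<Phi> xs"
    and "length xs + k = q"
  shows "measure_pmf.prob (extend_pmf S k xs) {ys. E ys} \<le> \<Phi> xs"
  using assms(3)
proof (induction k arbitrary: xs)
  case 0
  then show ?case using final[of xs] by (simp add: indicator_def)
next
  case (Suc k)
  have S: "finite (S xs)" "S xs \<noteq> {}"
    and le: "(\<Sum>x\<in>S xs. \<Phi> (xs @ [x])) \<le> real (card (S xs)) * \<Phi> xs"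
    using step[of xs] Suc.prems by auto
  then have c: "0 < real (card (S xs))" by (simp add: card_gt_0_iff)
  have "measure_pmf.prob (extend_pmf S (Suc k) xs) {ys. E ys}
      = (\<Sum>x\<in>S xs. measure_pmf.prob (extend_pmf S k (xs @ [x])) {ys. E ys}) / real (card (S xs))"
    using S by (simp add: prob_bind_pmf_of_set)
  also have "\<dots> \<le> (\<Sum>x\<in>S xs. \<Phi> (xs @ [x])) / real (card (S xs))"
    using Suc c by (intro divide_right_mono sum_mono) auto
  also have "\<dots> \<le> \<Phi> xs"
    using le c by (simp add: divide_le_eq mult.commute)
  finally show ?case .
qed

text \<open>A union bound over time in which the bad set \<open>R\<close> may react to all earlier
  queries: \<open>\<Phi>\<close> is the indicator of a past hit plus the bounds
  \<open>\<beta>\<close> still to come.\<close>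

lemma prob_extend_pmf_hit_le:
  fixes \<beta> :: "nat \<Rightarrow> real"
  assumes step: "\<And>xs. length xs < q \<Longrightarrow> finite (S xs) \<and> S xs \<noteq> {} \<and>
      real (card {x\<in>S xs. R xs x}) \<le> real (card (S xs)) * \<beta> (length xs)"
  shows "measure_pmf.prob (extend_pmf S q []) {ys. \<exists>i<length ys. R (take i ys) (ys ! i)} \<le> (\<Sum>i<q. \<beta> i)"
proof -
  define H where "H ys \<longleftrightarrow> (\<exists>i<length ys. R (take i ys) (ys ! i))" for ys
  define \<Phi> where "\<Phi> ys = of_bool (H ys) + (\<Sum>i\<in>{length ys..<q}. \<beta> i)" for ys
  have H_snoc: "H (xs @ [x]) \<longleftrightarrow> H xs \<or> R xs x" for xs x
  proof -
    have "H (xs @ [x]) \<longleftrightarrow> (\<exists>i<length xs. R (take i (xs @ [x])) ((xs @ [x]) ! i)) \<or> R xs x"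
      unfolding H_def by (simp add: less_Suc_eq conj_disj_distribR ex_disj_distrib)
    also have "(\<exists>i<length xs. R (take i (xs @ [x])) ((xs @ [x]) ! i)) \<longleftrightarrow> H xs"
      unfolding H_def by (intro ex_cong1 conj_cong refl) (simp add: nth_append)
    finally show ?thesis .
  qed
  have "measure_pmf.prob (extend_pmf S q []) {ys. H ys} \<le> \<Phi> []"
  proof (rule prob_extend_pmf_le)
    fix xs :: "nat list" assume len: "length xs < q"
    note S = step[OF len]
    have "(\<Sum>x\<in>S xs. of_bool (H (xs @ [x])) :: real) \<le> (\<Sum>x\<in>S xs. of_bool (H xs) + of_bool (R xs x))"
      by (intro sum_mono) (auto simp: H_snoc)
    also have "\<dots> = real (card (S xs)) * of_bool (H xs) + real (card {x\<in>S xs. R xs x})"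
      using S by (simp add: sum.distrib Int_def)
    also have "\<dots> \<le> real (card (S xs)) * (of_bool (H xs) + \<beta> (length xs))"
      using S by (simp add: distrib_left)
    finally have "(\<Sum>x\<in>S xs. \<Phi> (xs @ [x])) \<le>
        real (card (S xs)) * (of_bool (H xs) + \<beta> (length xs) + (\<Sum>i\<in>{Suc (length xs)..<q}. \<beta> i))"
      unfolding \<Phi>_def by (simp add: sum.distrib distrib_left)
    also have "\<dots> = real (card (S xs)) * \<Phi> xs"
      unfolding \<Phi>_def using len by (simp add: sum.atLeast_Suc_lessThan)
    finally show "finite (S xs) \<and> S xs \<noteq> {} \<and> (\<Sum>x\<in>S xs. \<Phi> (xs @ [x])) \<le> real (card (S xs)) * \<Phi> xs"
      using S by simp
  qed (auto simp: \<Phi>_def)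
  then show ?thesis
    unfolding \<Phi>_def by (simp add: H_def atLeast0LessThan)
qed

section \<open>The two-phase tester\<close>

definition succs :: "(nat \<Rightarrow> nat \<Rightarrow> bool) \<Rightarrow> nat \<Rightarrow> nat \<Rightarrow> nat \<Rightarrow> nat set" where
  "succs B n L a = {y. \<exists>j\<le>L. y = a + 2 ^ j \<and> y \<le> n \<and> B a y}"

lemma succs_eq: "succs B n L a = (\<lambda>j. a + 2 ^ j) ` {j\<in>{..L}. a + 2 ^ j \<le> n \<and> B a (a + 2 ^ j)}"
  by (auto simp: succs_def)

lemma finite_succs [simp]: "finite (succs B n L a)"
  by (simp add: succs_eq)

lemma card_succs: "card (succs B n L a) = card {j\<in>{..L}. a + 2 ^ j \<le> n \<and> B a (a + 2 ^ j)}"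
  unfolding succs_eq by (rule card_image) (auto simp: inj_on_def)

lemma card_succs_le: "card (succs B n L a) \<le> Suc L"
  unfolding card_succs by (rule order_trans[OF card_mono[of "{..L}"]]) auto

lemma succs_subset: "succs B n L a \<subseteq> {1..n}"
  by (auto simp: succs_def Suc_le_eq)

lemma succs_mono: "(\<And>y. B a y \<Longrightarrow> B' a y) \<Longrightarrow> succs B n L a \<subseteq> succs B' n L a"
  by (auto simp: succs_def)

lemma card_preds_le: "card {a\<in>X. y \<in> succs B n L a} \<le> Suc L"
proof -
  have "card {a\<in>X. y \<in> succs B n L a} \<le> card ((\<lambda>j. y - 2 ^ j) ` {..L})"
    by (intro card_mono) (force simp: succs_def)+
  also have "\<dots> \<le> Suc L" using card_image_le[of "{..L}"] by simp
  finally show ?thesis .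
qed

lemma sum_card_succs:
  "(\<Sum>a\<in>{1..n}. card (succs B n L a)) = (\<Sum>j\<le>L. card {a\<in>{1..n - 2 ^ j}. B a (a + 2 ^ j)})"
proof -
  have "(\<Sum>a\<in>{1..n}. card (succs B n L a)) = (\<Sum>a\<in>{1..n}. \<Sum>j\<le>L. of_bool (a + 2 ^ j \<le> n \<and> B a (a + 2 ^ j)))"
    by (simp add: card_succs Int_def)
  also have "\<dots> = (\<Sum>j\<le>L. \<Sum>a\<in>{1..n}. of_bool (a + 2 ^ j \<le> n \<and> B a (a + 2 ^ j)))"
    by (rule sum.swap)
  also have "\<dots> = (\<Sum>j\<le>L. card {a\<in>{1..n - 2 ^ j}. B a (a + 2 ^ j)})"
    by (intro sum.cong refl) (auto intro!: arg_cong[of _ _ card])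
  finally show ?thesis .
qed

text \<open>Padding the second-phase set to a fixed size makes every altered point equally
  likely to be queried, however many differences \<open>y - a = 2 ^ j\<close> it accounts for.\<close>

definition pad_set :: "nat \<Rightarrow> nat \<Rightarrow> nat set \<Rightarrow> nat set" where
  "pad_set n s N = (SOME Z. N \<subseteq> Z \<and> Z \<subseteq> {1..n} \<and> card Z = s)"

lemma pad_set:
  assumes "N \<subseteq> {1..n}" "card N \<le> s" "s \<le> n"
  shows "N \<subseteq> pad_set n s N" "pad_set n s N \<subseteq> {1..n}" "card (pad_set n s N) = s"
proof -
  have "\<exists>Z. N \<subseteq> Z \<and> Z \<subseteq> {1..n} \<and> card Z = s"
    using exists_subset_between[of N s "{1..n}"] assms by auto
  from someI_ex[OF this] show "N \<subseteq> pad_set n s N" "pad_set n s N \<subseteq> {1..n}" "card (pad_set n s N) = s"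
    unfolding pad_set_def by auto
qed

text \<open>\<open>take m xs\<close> freezes the set once the first phase is over, so the second
  phase draws from a single set. Its size \<open>m * Suc L\<close> is the most that \<open>m\<close>
  points can have as successors.\<close>

definition query_set :: "nat \<Rightarrow> nat \<Rightarrow> nat \<Rightarrow> nat list \<Rightarrow> nat set" where
  "query_set n L m xs = (if length xs < m then {1..n}
     else pad_set n (m * Suc L) (\<Union>a\<in>set (take m xs). succs (\<lambda>_ _. True) n L a))"

lemma query_set_late:
  assumes "m * Suc L \<le> n" "m \<le> length xs"
  shows "(\<Union>a\<in>set (take m xs). succs B n L a) \<subseteq> query_set n L m xs"
    "query_set n L m xs \<subseteq> {1..n}" "card (query_set n L m xs) = m * Suc L"
proof -
  let ?N = "\<Union>a\<in>set (take m xs). succs (\<lambda>_ _. True) n L a"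
  have "card ?N \<le> (\<Sum>a\<in>set (take m xs). card (succs (\<lambda>_ _. True) n L a))"
    by (rule card_UN_le) simp
  also have "\<dots> \<le> card (set (take m xs)) * Suc L"
    using sum_bounded_above[of "set (take m xs)" "\<lambda>a. card (succs (\<lambda>_ _. True) n L a)" "Suc L"]
      card_succs_le by simp
  also have "\<dots> \<le> m * Suc L"
    using card_length[of "take m xs"] by (intro mult_le_mono1) simp
  finally have "card ?N \<le> m * Suc L" .
  moreover have "?N \<subseteq> {1..n}" using succs_subset by blast
  ultimately have *: "?N \<subseteq> query_set n L m xs" "query_set n L m xs \<subseteq> {1..n}"
    "card (query_set n L m xs) = m * Suc L"
    using pad_set[of ?N n "m * Suc L"] assms unfolding query_set_def by auto
  then show "query_set n L m xs \<subseteq> {1..n}" "card (query_set n L m xs) = m * Suc L" by auto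
  show "(\<Union>a\<in>set (take m xs). succs B n L a) \<subseteq> query_set n L m xs"
    using *(1) succs_mono[of B _ "\<lambda>_ _. True"] by blast
qed

lemma query_set:
  assumes "m * Suc L \<le> n" "0 < m"
  shows "query_set n L m xs \<subseteq> {1..n}" "finite (query_set n L m xs)" "query_set n L m xs \<noteq> {}"
    and "card (query_set n L m xs) = (if length xs < m then n else m * Suc L)"
proof -
  have "0 < m * Suc L" using assms by simp
  then have n: "0 < n" using assms(1) by linarith
  show 1: "query_set n L m xs \<subseteq> {1..n}"
    using query_set_late[OF assms(1)] by (cases "length xs < m") (auto simp: query_set_def)
  then show "finite (query_set n L m xs)" by (rule finite_subset) simp
  show 2: "card (query_set n L m xs) = (if length xs < m then n else m * Suc L)"
    using query_set_late[OF assms(1)] by (cases "length xs < m") (auto simp: query_set_def)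
  then show "query_set n L m xs \<noteq> {}" using n \<open>0 < m * Suc L\<close> by (auto split: if_splits)
qed

text \<open>Erased answers impose nothing, so erasures never make a member of \<open>P\<close> look
  inconsistent; this gives one-sided error. Corrupted answers can.\<close>

definition consistent :: "(nat \<Rightarrow> real) set \<Rightarrow> history \<Rightarrow> bool" where
  "consistent P h \<longleftrightarrow> (\<exists>g\<in>P. \<forall>(r, x, a)\<in>set h. a = None \<or> a = Some (g x))"

definition two_phase_tester :: "nat \<Rightarrow> nat \<Rightarrow> nat \<Rightarrow> (nat \<Rightarrow> real) set \<Rightarrow> tester" where
  "two_phase_tester n L m P = sampling_tester (2 * m) (query_set n L m) (consistent P)"

section \<open>The chance of finding a conflict\<close>

lemma exp_minus_le: "0 \<le> z \<Longrightarrow> z \<le> 1 \<Longrightarrow> exp (- z) \<le> 1 - z / 2" for z :: real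
proof -
  assume z: "0 \<le> z" "z \<le> 1"
  have "1 \<le> (1 - z / 2) * (1 + z)" using z mult_left_mono[of z 1 z] by (simp add: algebra_simps)
  also have "\<dots> \<le> (1 - z / 2) * exp z" using z by (intro mult_left_mono) auto
  finally show ?thesis by (simp add: exp_minus field_simps)
qed

text \<open>\<open>U\<close> holds the conflicting successors collected so far. A point is a
  successor of at most one point per scale, so a small \<open>U\<close> uses up at most half of
  \<open>2 ^ L\<close> pairs, and a uniform \<open>x\<close> brings on average at least
  \<open>2 ^ L / (2 * n)\<close> new successors. One \<open>x\<close> adds at most
  \<open>Suc L\<close>; dividing by it keeps the exponent in the range of
  \<open>exp_minus_le\<close>.\<close>

lemma sum_exp_card_succs_le:
  assumes U: "finite U" "card U \<le> 3 * Suc L"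
    and B: "2 ^ L \<le> (\<Sum>a\<in>{1..n}. card (succs B n L a))"
    and L: "6 * (Suc L * Suc L) \<le> 2 ^ L"
  shows "(\<Sum>x\<in>{1..n}. exp (- real (card (U \<union> succs B n L x)) / Suc L))
    \<le> real n * (1 - 2 ^ L / (4 * real (Suc L) * real n)) * exp (- real (card U) / Suc L)"
proof -
  let ?d = "\<lambda>x. card (succs B n L x - U)" and ?\<Lambda> = "real (Suc L)"
  have "(\<Sum>x\<in>{1..n}. card (succs B n L x \<inter> U)) = (\<Sum>x\<in>{1..n}. \<Sum>y\<in>U. of_bool (y \<in> succs B n L x))"
    using U by (simp add: Int_commute)
  also have "\<dots> = (\<Sum>y\<in>U. \<Sum>x\<in>{1..n}. of_bool (y \<in> succs B n L x))"
    by (rule sum.swap)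
  also have "\<dots> = (\<Sum>y\<in>U. card {x\<in>{1..n}. y \<in> succs B n L x})"
    by (simp add: Int_def)
  also have "\<dots> \<le> card U * Suc L"
    using sum_bounded_above[of U "\<lambda>y. card {x\<in>{1..n}. y \<in> succs B n L x}" "Suc L"]
    by (simp only: card_preds_le of_nat_id)
  finally have "(\<Sum>x\<in>{1..n}. card (succs B n L x \<inter> U)) \<le> card U * Suc L" .
  moreover have "(\<Sum>x\<in>{1..n}. card (succs B n L x)) = (\<Sum>x\<in>{1..n}. card (succs B n L x \<inter> U)) + (\<Sum>x\<in>{1..n}. ?d x)"
    by (simp only: sum.distrib[symmetric] card_Int_Diff[OF finite_succs, of _ _ _ _ U, symmetric])
  moreover have "2 * (card U * Suc L) \<le> 2 ^ L"
    using mult_le_mono1[OF U(2), of "Suc L"] L by linarith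
  ultimately have "2 ^ L \<le> 2 * (\<Sum>x\<in>{1..n}. ?d x)"
    using B by linarith
  then have "real (2 ^ L) \<le> real (2 * (\<Sum>x\<in>{1..n}. ?d x))"
    by (rule of_nat_mono)
  then have d: "2 ^ L / 2 \<le> (\<Sum>x\<in>{1..n}. real (?d x))" by simp
  have n: "0 < n"
  proof (rule ccontr)
    assume "\<not> 0 < n"
    then have "2 ^ L / 2 \<le> (0::real)" using d by simp
    moreover have "(0::real) < 2 ^ L / 2" by simp
    ultimately show False by linarith
  qed
  have "(\<Sum>x\<in>{1..n}. exp (- real (card (U \<union> succs B n L x)) / ?\<Lambda>))
     = (\<Sum>x\<in>{1..n}. exp (- real (card U) / ?\<Lambda>) * exp (- (real (?d x) / ?\<Lambda>)))"
  proof (intro sum.cong refl)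
    fix x
    have "card (U \<union> succs B n L x) = card (U \<union> (succs B n L x - U))" by simp
    also have "\<dots> = card U + ?d x" using U by (intro card_Un_disjoint) auto
    finally show "exp (- real (card (U \<union> succs B n L x)) / ?\<Lambda>) = exp (- real (card U) / ?\<Lambda>) * exp (- (real (?d x) / ?\<Lambda>))"
      by (simp add: exp_add[symmetric] diff_divide_distrib)
  qed
  also have "\<dots> \<le> (\<Sum>x\<in>{1..n}. exp (- real (card U) / ?\<Lambda>) * (1 - real (?d x) / ?\<Lambda> / 2))"
  proof (intro sum_mono mult_left_mono exp_minus_le)
    fix x
    have "?d x \<le> Suc L" using card_mono[of "succs B n L x" "succs B n L x - U"] card_succs_le[of B n L x] by simp
    then show "real (?d x) / ?\<Lambda> \<le> 1" by simp
  qed auto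
  also have "\<dots> = exp (- real (card U) / ?\<Lambda>) * (real n - (\<Sum>x\<in>{1..n}. real (?d x)) / (2 * ?\<Lambda>))"
    by (simp add: sum_distrib_left[symmetric] sum_subtractf sum_divide_distrib[symmetric])
  also have "\<dots> \<le> exp (- real (card U) / ?\<Lambda>) * (real n - (2 ^ L / 2) / (2 * ?\<Lambda>))"
    by (intro mult_left_mono diff_left_mono divide_right_mono d) auto
  also have "\<dots> = real n * (1 - 2 ^ L / (4 * real (Suc L) * real n)) * exp (- real (card U) / Suc L)"
  proof -
    have "real n * (1 - 2 ^ L / (4 * ?\<Lambda> * real n)) = real n - (2 ^ L / 2) / (2 * ?\<Lambda>)"
      using n by (simp add: right_diff_distrib)
    then show ?thesis by (simp only: mult.commute)
  qed
  finally show ?thesis .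
qed

text \<open>One potential serves both phases. In the second, with \<open>k\<close> draws left from a
  set of size \<open>s\<close>, \<open>exp (- k * card W / s)\<close> dominates the chance to miss
  \<open>W\<close>. In the first, \<open>\<Psi>\<close> expresses that this exponential approaches
  the floor \<open>exp (- 3)\<close> by a factor \<open>1 - \<theta> L n\<close> per draw.\<close>

lemma prob_no_pair_le:
  fixes B :: "nat \<Rightarrow> nat \<Rightarrow> bool"
  defines "\<theta> L n \<equiv> 2 ^ L / (4 * real (Suc L) * real n)"
  assumes m: "m * Suc L \<le> n" "0 < m"
    and B: "2 ^ L \<le> (\<Sum>a\<in>{1..n}. card (succs B n L a))"
    and L: "6 * (Suc L * Suc L) \<le> 2 ^ L"
  shows "measure_pmf.prob (extend_pmf (query_set n L m) (2 * m) []) {xs. \<not> (\<exists>a\<in>set xs. \<exists>y\<in>set xs. B a y)}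
    \<le> (1 - \<theta> L n) ^ m * (1 - exp (- 3)) + exp (- 3)"
proof -
  define W where "W xs = (\<Union>a\<in>set xs. succs B n L a)" for xs
  define s where "s = m * Suc L"
  define \<Psi> where "\<Psi> j xs = (1 - \<theta> L n) ^ j * (exp (- real (card (W xs)) / Suc L) - exp (- 3)) + exp (- 3)" for j xs
  \<comment> \<open>\<open>\<Psi>\<close> is affine in the exponential so that the supermartingale inequality survives once
    \<open>W xs\<close> exceeds \<open>3 * Suc L\<close>, where no further growth can be guaranteed.\<close>
  define \<Phi> where "\<Phi> xs = (if length xs < m then \<Psi> (m - length xs) xs
     else if \<exists>y\<in>set (drop m xs). y \<in> W (take m xs) then 0
     else exp (- real (2 * m - length xs) * real (card (W (take m xs))) / real s))" for xs
  have s: "0 < s" using m by (simp add: s_def)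
  have n: "0 < n" using m s unfolding s_def by linarith
  have fin: "finite (W xs)" for xs by (simp add: W_def)
  have "(\<Sum>a\<in>{1..n}. card (succs B n L a)) \<le> n * Suc L"
    using sum_bounded_above[of "{1..n}" "\<lambda>a. card (succs B n L a)" "Suc L"] card_succs_le by simp
  then have "2 ^ L \<le> n * Suc L" using B by linarith
  then have "real (2 ^ L) \<le> real (n * Suc L)" by (rule of_nat_mono)
  then have "2 ^ L \<le> real n * real (Suc L)" by (simp only: of_nat_power of_nat_numeral of_nat_mult)
  moreover have pos: "0 < real n * real (Suc L)" using n by simp
  ultimately have "2 ^ L \<le> 4 * (real n * real (Suc L))" by linarith
  then have "2 ^ L / (4 * (real n * real (Suc L))) \<le> 1"
    using pos by (subst divide_le_eq_1_pos) linarith+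
  then have \<theta>: "0 \<le> \<theta> L n" "\<theta> L n \<le> 1"
    unfolding \<theta>_def by (simp_all only: mult.commute mult.left_commute mult.assoc) simp
  have W_snoc: "W (xs @ [x]) = W xs \<union> succs B n L x" for xs x
    by (auto simp: W_def)
  \<comment> \<open>The formulas of the two phases meet here: \<open>m\<close> draws are left and
    \<open>s = m * Suc L\<close>, so \<open>m * card W / s = card W / Suc L\<close>.\<close>
  have \<Phi>_m: "\<Phi> xs = \<Psi> 0 xs" if "length xs = m" for xs
    using that m(2) by (simp add: \<Phi>_def \<Psi>_def s_def del: of_nat_Suc mult_Suc_right)
  have "measure_pmf.prob (extend_pmf (query_set n L m) (2 * m) []) {xs. \<not> (\<exists>a\<in>set xs. \<exists>y\<in>set xs. B a y)} \<le> \<Phi> []"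
  proof (rule prob_extend_pmf_le)
    fix xs :: "nat list" assume len: "length xs < 2 * m"
    note Q = query_set[OF m, of xs]
    have "(\<Sum>x\<in>query_set n L m xs. \<Phi> (xs @ [x])) \<le> real (card (query_set n L m xs)) * \<Phi> xs"
    proof (cases "length xs < m")
      case True
      obtain j where j: "m - length xs = Suc j" using True by (cases "m - length xs") auto
      have "\<Phi> (xs @ [x]) = \<Psi> j (xs @ [x])" for x
      proof (cases "Suc (length xs) < m")
        case True
        then have "m - Suc (length xs) = j" using j by linarith
        with True show ?thesis by (simp add: \<Phi>_def)
      next
        case False
        then have "j = 0" "length (xs @ [x]) = m" using j True by auto
        then show ?thesis using \<Phi>_m by simp
      qed
      then have "(\<Sum>x\<in>{1..n}. \<Phi> (xs @ [x]))
        = (1 - \<theta> L n) ^ j * ((\<Sum>x\<in>{1..n}. exp (- real (card (W xs \<union> succs B n L x)) / Suc L)) - real n * exp (- 3)) + real n * exp (- 3)"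
        by (simp add: \<Psi>_def W_snoc sum.distrib sum_distrib_left[symmetric] sum_subtractf del: of_nat_Suc)
      also have "\<dots> \<le> (1 - \<theta> L n) ^ j * (real n * (1 - \<theta> L n) * (exp (- real (card (W xs)) / Suc L) - exp (- 3))) + real n * exp (- 3)"
      proof (intro add_right_mono mult_left_mono)
        let ?e = "exp (- real (card (W xs)) / Suc L)"
        show "(\<Sum>x\<in>{1..n}. exp (- real (card (W xs \<union> succs B n L x)) / Suc L)) - real n * exp (- 3)
          \<le> real n * (1 - \<theta> L n) * (?e - exp (- 3))"
        proof (cases "card (W xs) \<le> 3 * Suc L")
          case True
          have "(\<Sum>x\<in>{1..n}. exp (- real (card (W xs \<union> succs B n L x)) / Suc L)) \<le> real n * (1 - \<theta> L n) * ?e"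
            unfolding \<theta>_def using sum_exp_card_succs_le[OF fin True B L] .
          moreover have "real n * (1 - \<theta> L n) * exp (- 3) \<le> real n * exp (- 3)"
            using \<theta> by (intro mult_right_mono mult_left_le) auto
          ultimately show ?thesis
            unfolding right_diff_distrib[of "real n * (1 - \<theta> L n)"] by linarith
        next
          case False
          have "(\<Sum>x\<in>{1..n}. exp (- real (card (W xs \<union> succs B n L x)) / Suc L)) \<le> (\<Sum>x\<in>{1..n}. ?e)"
            using fin by (intro sum_mono) (auto intro!: divide_right_mono card_mono)
          then have "(\<Sum>x\<in>{1..n}. exp (- real (card (W xs \<union> succs B n L x)) / Suc L)) - real n * exp (- 3) \<le> real n * (?e - exp (- 3))"
            by (simp add: right_diff_distrib)
          \<comment> \<open>With \<open>W\<close> this large the bracket is negative, so the factor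
            \<open>1 - \<theta> L n\<close> can only raise it, and it suffices that \<open>W\<close>
            never shrinks.\<close>
          also have "real n * (?e - exp (- 3)) \<le> real n * ((1 - \<theta> L n) * (?e - exp (- 3)))"
          proof (rule mult_left_mono)
            have "real (3 * Suc L) \<le> real (card (W xs))" using False by (intro of_nat_mono) simp
            then have "- real (card (W xs)) / Suc L \<le> - 3" by (simp add: field_simps)
            then have "?e - exp (- 3) \<le> 0" by (simp only: exp_le_cancel_iff diff_le_0_iff_le)
            from \<theta>(1) this have "1 * (?e - exp (- 3)) \<le> (1 - \<theta> L n) * (?e - exp (- 3))"
              by (intro mult_right_mono_neg) linarith+
            then show "?e - exp (- 3) \<le> (1 - \<theta> L n) * (?e - exp (- 3))"
              by (simp only: mult_1_left)
          qed simp
          finally show ?thesis by (simp only: mult.assoc)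
        qed
      qed (use \<theta> in auto)
      also have "\<dots> = real n * \<Psi> (Suc j) xs" by (simp add: \<Psi>_def algebra_simps)
      also have "\<Psi> (Suc j) xs = \<Phi> xs" using True j by (simp add: \<Phi>_def)
      finally show ?thesis using Q(4) True by (simp add: query_set_def)
    next
      case False
      let ?Q = "query_set n L m xs" and ?W = "W (take m xs)"
      define w where "w = real (card ?W)"
      have WQ: "?W \<subseteq> ?Q" using query_set_late(1)[OF m(1), of xs B] False by (simp add: W_def)
      have cQ: "card ?Q = s" using Q(4) False by (simp add: s_def)
      obtain j where j: "2 * m - length xs = Suc j" using len by (cases "2 * m - length xs") auto
      then have j': "2 * m - Suc (length xs) = j" by linarith
      show ?thesis
      proof (cases "\<exists>y\<in>set (drop m xs). y \<in> ?W")
        case True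
        then have "\<Phi> xs = 0" "\<Phi> (xs @ [x]) = 0" for x
          using False unfolding \<Phi>_def by auto
        then show ?thesis by simp
      next
        case no: False
        have "\<Phi> (xs @ [x]) = of_bool (x \<notin> ?W) * exp (- real j * w / s)" for x
          using False no j' by (auto simp: \<Phi>_def w_def)
        then have "(\<Sum>x\<in>?Q. \<Phi> (xs @ [x])) = real (card {x\<in>?Q. x \<notin> ?W}) * exp (- real j * w / s)"
          using Q(2) by (simp add: sum_distrib_right[symmetric] Int_def)
        also have "{x\<in>?Q. x \<notin> ?W} = ?Q - ?W" by auto
        also have "real (card (?Q - ?W)) = real s * (1 - w / s)"
          using s WQ card_mono[OF Q(2) WQ]
          by (simp add: card_Diff_subset fin cQ w_def of_nat_diff field_simps)
        also have "\<dots> * exp (- real j * w / s) \<le> real s * exp (- w / s) * exp (- real j * w / s)"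
          using exp_ge_add_one_self[of "- w / s"] by (intro mult_right_mono mult_left_mono) auto
        also have "\<dots> = real s * \<Phi> xs"
        proof -
          have "exp (- w / s) * exp (- real j * w / s) = exp (- real (Suc j) * w / s)"
            using s by (simp add: exp_add[symmetric] field_simps)
          moreover have "\<Phi> xs = exp (- real (Suc j) * w / s)"
            using False no by (simp only: \<Phi>_def w_def[symmetric] j if_False)
          ultimately show ?thesis by (simp only: mult.assoc)
        qed
        finally show ?thesis using cQ by simp
      qed
    qed
    then show "finite (query_set n L m xs) \<and> query_set n L m xs \<noteq> {} \<and>
        (\<Sum>x\<in>query_set n L m xs. \<Phi> (xs @ [x])) \<le> real (card (query_set n L m xs)) * \<Phi> xs"
      using Q by blast
  next
    fix xs :: "nat list" assume len: "length xs = 2 * m"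
    then have nlt: "\<not> length xs < m" using m(2) by simp
    show "of_bool (\<not> (\<exists>a\<in>set xs. \<exists>y\<in>set xs. B a y)) \<le> \<Phi> xs"
    proof (cases "\<exists>y\<in>set (drop m xs). y \<in> W (take m xs)")
      case True
      then obtain y a where "y \<in> set xs" "a \<in> set xs" "B a y"
        unfolding W_def succs_def by (blast dest: in_set_dropD in_set_takeD)
      then have "\<exists>a\<in>set xs. \<exists>y\<in>set xs. B a y" by blast
      with True show ?thesis using nlt by (simp add: \<Phi>_def)
    qed (use len nlt in \<open>simp add: \<Phi>_def\<close>)
  qed simp
  also have "\<Phi> [] = (1 - \<theta> L n) ^ m * (1 - exp (- 3)) + exp (- 3)"
    using m(2) by (simp add: \<Phi>_def \<Psi>_def W_def)
  finally show ?thesis .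
qed

section \<open>The chance of an altered answer\<close>

lemma card_altered_le:
  assumes "initial_input n f A" "budget_managing n t A"
  shows "real (card {x\<in>{1..n}. A xs x \<noteq> Some (f x)}) \<le> real (length xs) * t"
proof -
  have "{x\<in>{1..n}. A xs x \<noteq> Some (f x)} = {x\<in>{1..n}. A [] x \<noteq> A xs x}"
    using assms(1) unfolding initial_input_def by force
  then show ?thesis
    using assms(2) unfolding budget_managing_def Dist_def by simp
qed

lemma erasure_adversary_answer:
  assumes "erasure_adversary n t f A" "x \<in> {1..n}"
  shows "A xs x \<in> {Some (f x), None}"
proof (induction xs rule: rev_induct)
  case Nil
  then show ?case using assms by (simp add: erasure_adversary_def initial_input_def)
next
  case (snoc y xs)
  have "A (xs @ [y]) x \<in> {A xs x, None}"
    using assms unfolding erasure_adversary_def erasing_def by blast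
  with snoc show ?case by auto
qed

text \<open>Only the state of a point at the moment of its query counts; alterations made later, or
  undone in time, do no harm.\<close>

definition altered :: "strategy \<Rightarrow> (nat \<Rightarrow> real) \<Rightarrow> nat list \<Rightarrow> bool" where
  "altered A f xs \<longleftrightarrow> (\<exists>i<length xs. A (take i xs) (xs ! i) \<noteq> Some (f (xs ! i)))"

text \<open>At most \<open>2 * m * t\<close> points are altered at any query. A first-phase query is
  uniform among \<open>n\<close> points. The second-phase set is known to the adversary, who may
  spend everything there, but it has \<open>m * Suc L\<close> points. Each phase has
  \<open>m\<close> queries, whence the two terms.\<close>

lemma prob_altered_le:
  assumes "initial_input n f A" "budget_managing n t A" "0 < t"
    and m: "m * Suc L \<le> n" "0 < m"
  shows "measure_pmf.prob (extend_pmf (query_set n L m) (2 * m) []) {xs. altered A f xs}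
    \<le> 2 * real m * (real m * t) / real n + 2 * real m * t / real (Suc L)"
proof -
  define \<beta> where "\<beta> i = 2 * real m * t / (if i < m then real n else real (m * Suc L))" for i
  have n: "0 < n" using m by (cases n) auto
  have "measure_pmf.prob (extend_pmf (query_set n L m) (2 * m) []) {xs. altered A f xs} \<le> (\<Sum>i<2 * m. \<beta> i)"
    unfolding altered_def
  proof (rule prob_extend_pmf_hit_le)
    fix xs :: "nat list" assume len: "length xs < 2 * m"
    let ?Q = "query_set n L m xs"
    have "card {x\<in>?Q. A xs x \<noteq> Some (f x)} \<le> card {x\<in>{1..n}. A xs x \<noteq> Some (f x)}"
      using query_set(1)[OF m, of xs] by (intro card_mono) (simp, blast)
    then have "real (card {x\<in>?Q. A xs x \<noteq> Some (f x)}) \<le> real (length xs) * t"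
      using card_altered_le[OF assms(1,2), of xs] by linarith
    also have "\<dots> \<le> 2 * real m * t"
      using len \<open>0 < t\<close> by (intro mult_right_mono) auto
    also have "\<dots> = real (card ?Q) * \<beta> (length xs)"
      using query_set(4)[OF m, of xs] m n
      by (auto simp: \<beta>_def simp del: of_nat_Suc mult_Suc_right)
    finally show "finite ?Q \<and> ?Q \<noteq> {} \<and>
        real (card {x\<in>?Q. A xs x \<noteq> Some (f x)}) \<le> real (card ?Q) * \<beta> (length xs)"
      using query_set[OF m] by blast
  qed
  also have "(\<Sum>i<2 * m. \<beta> i) = (\<Sum>i<m. \<beta> i) + (\<Sum>i\<in>{m..<2 * m}. \<beta> i)"
    by (subst sum.union_disjoint[symmetric]) (auto intro!: sum.cong)
  also have "\<dots> = real m * (2 * real m * t / real n) + real m * (2 * real m * t / real (m * Suc L))"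
    by (simp add: \<beta>_def)
  also have "\<dots> = 2 * real m * (real m * t) / real n + 2 * real m * t / real (Suc L)"
    using m(2) by (simp add: mult_ac del: of_nat_Suc mult_Suc_right)
  finally show ?thesis .
qed

lemma mem_set_transcript:
  "x \<in> set xs \<Longrightarrow> \<not> altered A f xs \<Longrightarrow> \<exists>r. (r, x, Some (f x)) \<in> set (transcript A xs)"
  unfolding altered_def set_transcript in_set_conv_nth by (force simp: image_iff)

lemma consistent_unaltered:
  assumes "f \<in> P" "\<not> altered A f xs"
  shows "consistent P (transcript A xs)"
  using assms unfolding consistent_def altered_def set_transcript by auto

lemma conflict_not_consistent:
  assumes "\<not> altered A f xs" "a \<in> set xs" "b \<in> set xs" "conflict P f a b"
  shows "\<not> consistent P (transcript A xs)"
proof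
  assume "consistent P (transcript A xs)"
  then obtain g where g: "g \<in> P" "\<And>r x y. (r, x, y) \<in> set (transcript A xs) \<Longrightarrow> y = None \<or> y = Some (g x)"
    unfolding consistent_def by blast
  have "g x = f x" if "x \<in> set xs" for x
    using mem_set_transcript[OF that assms(1)] g(2) by fastforce
  then show False
    using assms(2-4) g(1) unfolding conflict_def by blast
qed

lemma prob_Not: "measure_pmf.prob p {x. \<not> Q x} = 1 - measure_pmf.prob p {x. Q x}"
  using measure_pmf.prob_compl[of "{x. Q x}" p] by (simp add: Compl_eq_Diff_UNIV[symmetric] Collect_neg_eq)

lemma two_phase_tester_accepts:
  assumes "initial_input n f A" "budget_managing n t A" "0 < t"
    and m: "m * Suc L \<le> n" "0 < m"
    and alt: "2 * real m * (real m * t) / real n + 2 * real m * t / real (Suc L) \<le> 1 / 6"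
    and f: "f \<in> P"
  shows "2 / 3 \<le> verdict_prob (two_phase_tester n L m P) A True"
proof -
  let ?X = "extend_pmf (query_set n L m) (2 * m) []"
  have "1 - measure_pmf.prob ?X {xs. altered A f xs} = measure_pmf.prob ?X {xs. \<not> altered A f xs}"
    by (rule prob_Not[symmetric])
  also have "\<dots> \<le> measure_pmf.prob ?X {xs. consistent P (transcript A xs) = True}"
    using consistent_unaltered[OF f] by (intro measure_pmf.finite_measure_mono) auto
  also have "\<dots> \<le> verdict_prob (two_phase_tester n L m P) A True"
    unfolding two_phase_tester_def by (rule verdict_prob_sampling_tester)
  finally show ?thesis using prob_altered_le[OF assms(1-3) m] alt by linarith
qed

lemma exp_minus_3_le: "exp (- 3) \<le> (1 / 12 :: real)"
proof -
  have "12 \<le> (5 / 2 :: real) ^ 3" by (simp add: power3_eq_cube)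
  also have "\<dots> \<le> exp 1 ^ 3"
    using exp_lower_Taylor_quadratic[of 1] by (intro power_mono) auto
  also have "exp 1 ^ 3 = (exp 3 :: real)" by (simp add: exp_of_nat_mult[symmetric])
  finally show ?thesis by (simp add: exp_minus field_simps)
qed

text \<open>The error 1/3 is split: 1/6 for an altered answer and 1/6 for missing every conflict,
  where both terms of \<open>prob_no_pair_le\<close> are at most
  \<open>exp (- 3) \<le> 1 / 12\<close>.\<close>

lemma two_phase_tester_rejects:
  assumes "initial_input n f A" "budget_managing n t A" "0 < t"
    and m: "m * Suc L \<le> n" "0 < m"
    and alt: "2 * real m * (real m * t) / real n + 2 * real m * t / real (Suc L) \<le> 1 / 6"
    and P: "local_property n P" and far: "eps_far n \<epsilon> P f"
    and L: "6 * (Suc L * Suc L) \<le> 2 ^ L" "2 * 2 ^ L \<le> n" "4 * 2 ^ L \<le> \<epsilon> * real n"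
    and enough: "3 \<le> real m * (2 ^ L / (4 * real (Suc L) * real n))"
  shows "2 / 3 \<le> verdict_prob (two_phase_tester n L m P) A False"
proof -
  let ?X = "extend_pmf (query_set n L m) (2 * m) []" and ?B = "conflict P f"
  let ?\<theta> = "2 ^ L / (4 * real (Suc L) * real n)"
  let ?miss = "{xs. \<not> (\<exists>a\<in>set xs. \<exists>y\<in>set xs. ?B a y)}"
  have \<theta>_le: "?\<theta> \<le> 1"
  proof -
    have "real (2 ^ L) \<le> real n" using L(2) by (intro of_nat_mono) simp
    also have "\<dots> \<le> 4 * real (Suc L) * real n"
      using mult_right_mono[of 1 "4 * real (Suc L)" "real n"] by simp
    finally have "2 ^ L \<le> 4 * real (Suc L) * real n" by simp
    moreover have "0 < n" using L(2) by (cases n) auto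
    ultimately show ?thesis by (subst divide_le_eq_1_pos) (auto simp del: of_nat_Suc)
  qed
  have "2 ^ L \<le> (\<Sum>a\<in>{1..n}. card (succs ?B n L a))"
    unfolding sum_card_succs by (rule eps_far_many_conflicts[OF P far L(2,3)])
  then have "measure_pmf.prob ?X ?miss \<le> (1 - ?\<theta>) ^ m * (1 - exp (- 3)) + exp (- 3)"
    by (rule prob_no_pair_le[OF m _ L(1)])
  also have "(1 - ?\<theta>) ^ m * (1 - exp (- 3)) \<le> (1 - ?\<theta>) ^ m"
  proof (rule mult_left_le)
    show "0 \<le> (1 - ?\<theta>) ^ m" using \<theta>_le by simp
  qed simp
  also have "(1 - ?\<theta>) ^ m \<le> exp (- 3)"
  proof -
    have "(1 - ?\<theta>) ^ m \<le> exp (- ?\<theta>) ^ m"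
    proof (rule power_mono)
      show "1 - ?\<theta> \<le> exp (- ?\<theta>)" using exp_ge_add_one_self[of "- ?\<theta>"] by linarith
    qed (use \<theta>_le in simp)
    also have "\<dots> = exp (- (real m * ?\<theta>))" by (simp add: exp_of_nat_mult[symmetric])
    also have "\<dots> \<le> exp (- 3)" using enough by (simp only: exp_le_cancel_iff neg_le_iff_le)
    finally show ?thesis .
  qed
  also have "exp (- 3) + exp (- 3) \<le> (1 / 6 :: real)" using exp_minus_3_le by simp
  finally have miss: "measure_pmf.prob ?X ?miss \<le> 1 / 6" by simp
  have "measure_pmf.prob ?X {xs. consistent P (transcript A xs)} \<le> measure_pmf.prob ?X ({xs. altered A f xs} \<union> ?miss)"
    using conflict_not_consistent by (intro measure_pmf.finite_measure_mono) (blast, simp)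
  also have "\<dots> \<le> measure_pmf.prob ?X {xs. altered A f xs} + measure_pmf.prob ?X ?miss"
    by (rule measure_Un_le) auto
  finally have "measure_pmf.prob ?X {xs. consistent P (transcript A xs)} \<le> 1 / 3"
    using miss prob_altered_le[OF assms(1-3) m] alt by linarith
  then have "2 / 3 \<le> measure_pmf.prob ?X {xs. consistent P (transcript A xs) = False}"
    by (simp add: prob_Not)
  also have "\<dots> \<le> verdict_prob (two_phase_tester n L m P) A False"
    unfolding two_phase_tester_def by (rule verdict_prob_sampling_tester)
  finally show ?thesis .
qed

lemma two_phase_tester_one_sided:
  assumes "m * Suc L \<le> n" "0 < m"
  shows "one_sided P (erasure_adversary n t) (two_phase_tester n L m P)"
  unfolding one_sided_def
proof (intro ballI allI impI)
  fix f A assume f: "f \<in> P" and A: "erasure_adversary n t f A"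
  let ?X = "extend_pmf (query_set n L m) (2 * m) []"
  let ?R = "\<lambda>xs x. x \<notin> {1..n}"
  note Q = query_set[OF assms]
  \<comment> \<open>The adversary is bound only on \<open>{1..n}\<close>, so probability exactly 1
    requires the queries to stay there almost surely: the hit bound with rate 0.\<close>
  have "measure_pmf.prob ?X {ys. \<exists>i<length ys. ?R (take i ys) (ys ! i)} \<le> (\<Sum>i<2 * m. 0)"
  proof (rule prob_extend_pmf_hit_le)
    fix xs :: "nat list"
    have "{x\<in>query_set n L m xs. x \<notin> {1..n}} = {}" using Q(1)[of xs] by blast
    then show "finite (query_set n L m xs) \<and> query_set n L m xs \<noteq> {} \<and>
        real (card {x\<in>query_set n L m xs. x \<notin> {1..n}}) \<le> real (card (query_set n L m xs)) * 0"
      using Q(2,3)[of xs] by (simp only: card.empty) simp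
  qed
  then have "1 \<le> measure_pmf.prob ?X {ys. \<not> (\<exists>i<length ys. ?R (take i ys) (ys ! i))}"
    unfolding prob_Not by simp
  also have "\<dots> \<le> measure_pmf.prob ?X {ys. consistent P (transcript A ys) = True}"
  proof (intro measure_pmf.finite_measure_mono subsetI CollectI)
    fix ys assume "ys \<in> {ys. \<not> (\<exists>i<length ys. ?R (take i ys) (ys ! i))}"
    then have "ys ! i \<in> {1..n}" if "i < length ys" for i using that by blast
    then have "A (take i ys) (ys ! i) \<in> {Some (f (ys ! i)), None}" if "i < length ys" for i
      using erasure_adversary_answer[OF A] that by blast
    then show "consistent P (transcript A ys) = True"
      using f unfolding consistent_def set_transcript by fastforce
  qed simp
  also have "\<dots> \<le> verdict_prob (two_phase_tester n L m P) A True"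
    unfolding two_phase_tester_def by (rule verdict_prob_sampling_tester)
  finally show "verdict_prob (two_phase_tester n L m P) A True = 1"
    using verdict_prob_le_1 by (intro antisym)
qed

lemma queries_in_two_phase_tester:
  assumes "m * Suc L \<le> n" "0 < m"
  shows "queries_in n (two_phase_tester n L m P)"
  unfolding queries_in_def
proof (intro allI impI)
  fix h r x assume "(r, Query x) \<in> set_pmf (two_phase_tester n L m P h)"
  then have "x \<in> query_set n L m (queries h)"
    using query_set(2,3)[OF assms]
    by (auto simp: two_phase_tester_def sampling_tester_def split: if_splits)
  then show "x \<in> {1..n}" using query_set(1)[OF assms] by blast
qed

lemma makes_at_most_queries_two_phase_tester:
  "makes_at_most_queries (2 * m) (two_phase_tester n L m P)"
  unfolding makes_at_most_queries_def
  by (auto simp: two_phase_tester_def sampling_tester_def)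

section \<open>Choice of the parameters\<close>

lemma square_le_two_power: "13 \<le> L \<Longrightarrow> 25 * (Suc L * Suc L) \<le> 2 ^ L"
proof (induction L rule: dec_induct)
  case base
  then show ?case by simp
next
  case (step L)
  have "25 * (Suc (Suc L) * Suc (Suc L)) \<le> 2 * (25 * (Suc L * Suc L))"
    using mult_le_mono[OF step(1) step(1)] step(1) by simp
  then show ?case using step by simp
qed

lemma local_property_tester:
  assumes P: "local_property n P" and \<epsilon>: "0 < \<epsilon>" "\<epsilon> < 1" and n: "2 ^ 15 \<le> \<epsilon> * real n"
    and t: "0 < t" "t \<le> \<epsilon> / 2400"
  shows "\<exists>T q. real q \<le> 194 * (log 2 (\<epsilon> * real n) / \<epsilon>) \<and> makes_at_most_queries q T \<and>
    eps_tester n \<epsilon> P (erasure_adversary n t) T \<and> one_sided P (erasure_adversary n t) T \<and>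
    eps_tester n \<epsilon> P (corruption_adversary n t) T"
proof -
  \<comment> \<open>Rounding down gives
    \<open>4 * 2 ^ L \<le> \<epsilon> * real n < 8 * 2 ^ L\<close>: the left side makes repairs
    cheap enough, the right side makes conflicts frequent enough.\<close>
  define L where "L = nat \<lfloor>log 2 (\<epsilon> * real n / 4)\<rfloor>"
  define \<Lambda> where "\<Lambda> = real (Suc L)"
  \<comment> \<open>\<open>96 = 3 * 4 * 8\<close>: in \<open>enough\<close>, 3 is the exponent to be
    reached, 4 comes from the drift per draw and 8 from the rounding in \<open>L\<close>. Rounding
    up turns 96 into 97, and two phases make 194.\<close>
  define m where "m = nat \<lceil>96 * (\<Lambda> / \<epsilon>)\<rceil>"
  have pos: "0 < \<epsilon> * real n / 4" using n by simp
  then have n0: "0 < real n" using \<epsilon> by (simp add: zero_less_mult_iff)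
  have "13 \<le> log 2 (\<epsilon> * real n / 4)"
    using n by (subst le_log_iff) (auto simp: powr_numeral)
  then have L13: "13 \<le> L" and flo: "real L = of_int \<lfloor>log 2 (\<epsilon> * real n / 4)\<rfloor>"
    by (auto simp: L_def le_nat_iff le_floor_iff)
  have "real L \<le> log 2 (\<epsilon> * real n / 4)" using flo by linarith
  then have "2 powr real L \<le> \<epsilon> * real n / 4" using pos by (simp add: le_log_iff)
  then have L_le: "4 * 2 ^ L \<le> \<epsilon> * real n" by (simp add: powr_realpow)
  have "log 2 (\<epsilon> * real n / 4) < real (Suc L)" using flo by linarith
  then have "\<epsilon> * real n / 4 < 2 powr real (Suc L)" using pos by (simp add: log_less_iff)
  then have L_gt: "\<epsilon> * real n < 8 * 2 ^ L" by (simp only: powr_realpow zero_less_numeral) simp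
  have "log 2 (\<epsilon> * real n / 4) = log 2 (\<epsilon> * real n) - 2"
    using n0 \<epsilon> log_divide[of 2 "\<epsilon> * real n" 4] log_pow_cancel[of "2 :: real" 2] by simp
  then have \<Lambda>_le: "\<Lambda> \<le> log 2 (\<epsilon> * real n)" using \<open>real L \<le> _\<close> by (simp add: \<Lambda>_def)
  have "1 \<le> \<Lambda>" by (simp add: \<Lambda>_def)
  have \<Lambda>1: "1 \<le> \<Lambda> / \<epsilon>" using \<epsilon> \<open>1 \<le> \<Lambda>\<close> by (simp add: le_divide_eq)
  have m_ge: "96 * (\<Lambda> / \<epsilon>) \<le> real m" unfolding m_def by (rule real_nat_ceiling_ge)
  have "0 \<le> 96 * (\<Lambda> / \<epsilon>)" using \<Lambda>1 by simp
  then have "real m = of_int \<lceil>96 * (\<Lambda> / \<epsilon>)\<rceil>"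
    unfolding m_def by (intro of_nat_nat) linarith
  then have "real m \<le> 96 * (\<Lambda> / \<epsilon>) + 1" by linarith
  then have m_le: "real m \<le> 97 * (\<Lambda> / \<epsilon>)" using \<Lambda>1 by simp
  have m0: "0 < m" using m_ge \<Lambda>1 by (cases m) auto
  \<comment> \<open>The bound \<open>2 ^ 15\<close> forces \<open>L \<ge> 13\<close>, the first
    value at which \<open>25 * (Suc L * Suc L)\<close> fits below \<open>2 ^ L\<close>. Squares of
    \<open>\<Lambda>\<close> enter through the size of the second-phase set and the first alteration
    term.\<close>
  have sq: "25 * (Suc L * Suc L) \<le> 2 ^ L" by (rule square_le_two_power[OF L13])
  then have "real (25 * (Suc L * Suc L)) \<le> real (2 ^ L)" by (rule of_nat_mono)
  then have sqr: "25 * (\<Lambda> * \<Lambda>) \<le> 2 ^ L"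
    by (simp only: of_nat_mult of_nat_power of_nat_numeral \<Lambda>_def)
  have sq_n: "100 * (\<Lambda> * \<Lambda>) \<le> \<epsilon> * real n" using sqr L_le by linarith
  have "real (m * Suc L) \<le> 97 * (\<Lambda> / \<epsilon>) * \<Lambda>"
    using m_le by (simp only: of_nat_mult \<Lambda>_def[symmetric]) (intro mult_right_mono, use \<open>1 \<le> \<Lambda>\<close> in auto)
  also have "\<dots> \<le> real n"
  proof -
    have "97 * (\<Lambda> * \<Lambda>) \<le> \<epsilon> * real n"
      using sq_n zero_le_square[of \<Lambda>] by linarith
    then have "97 * (\<Lambda> * \<Lambda>) / \<epsilon> \<le> real n"
      using \<epsilon> by (simp add: divide_le_eq mult.commute)
    then show ?thesis by (simp add: mult.assoc)
  qed
  finally have ms: "m * Suc L \<le> n" by (simp only: of_nat_le_iff)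
  have "real (2 * 2 ^ L) \<le> real n"
  proof -
    have "\<epsilon> * real n \<le> real n" using \<epsilon> n0 by simp
    then show ?thesis using L_le by simp
  qed
  then have Ln: "2 * 2 ^ L \<le> n" by (simp only: of_nat_le_iff)
  have enough: "3 \<le> real m * (2 ^ L / (4 * \<Lambda> * real n))"
  proof -
    have "3 \<le> 24 * 2 ^ L / (\<epsilon> * real n)"
      using L_gt n0 \<epsilon> by (simp add: le_divide_eq)
    also have "\<dots> = (96 * (\<Lambda> / \<epsilon>)) * (2 ^ L / (4 * \<Lambda> * real n))"
      using n0 \<epsilon> \<open>1 \<le> \<Lambda>\<close> by (simp add: field_simps)
    also have "\<dots> \<le> real m * (2 ^ L / (4 * \<Lambda> * real n))"
      using \<open>1 \<le> \<Lambda>\<close> by (intro mult_right_mono m_ge) auto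
    finally show ?thesis .
  qed
  have mt: "real m * t \<le> 97 / 2400 * \<Lambda>"
  proof -
    have "real m * t \<le> 97 * (\<Lambda> / \<epsilon>) * (\<epsilon> / 2400)"
      using t \<Lambda>1 by (intro mult_mono m_le) auto
    then show ?thesis using \<epsilon> by simp
  qed
  \<comment> \<open>The constant 2400 is set here: the two terms are at most about 0.078 and 0.081,
    together below 1/6.\<close>
  have alt: "2 * real m * (real m * t) / real n + 2 * real m * t / \<Lambda> \<le> 1 / 6"
  proof -
    have "2 * real m * t / \<Lambda> \<le> 194 / 2400"
      using mt \<open>1 \<le> \<Lambda>\<close> by (simp add: divide_le_eq mult.assoc)
    moreover have "real m * (real m * t) \<le> 97 * (\<Lambda> / \<epsilon>) * (97 / 2400 * \<Lambda>)"
      using t \<Lambda>1 by (intro mult_mono m_le mt) auto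
    then have "2 * real m * (real m * t) / real n \<le> 2 * (97 * (\<Lambda> / \<epsilon>) * (97 / 2400 * \<Lambda>)) / real n"
      by (intro divide_right_mono) (auto simp: mult.assoc)
    moreover have "\<dots> = (2 * 97 * 97 / 2400) * ((\<Lambda> * \<Lambda>) / (\<epsilon> * real n))"
      by simp
    moreover have "(\<Lambda> * \<Lambda>) / (\<epsilon> * real n) \<le> 1 / 100"
      using sq_n pos by (simp add: divide_le_eq)
    ultimately show ?thesis by linarith
  qed
  let ?T = "two_phase_tester n L m P"
  have L6: "6 * (Suc L * Suc L) \<le> 2 ^ L" using sq by linarith
  have "real (2 * m) \<le> 194 * (log 2 (\<epsilon> * real n) / \<epsilon>)"
  proof -
    have "\<Lambda> / \<epsilon> \<le> log 2 (\<epsilon> * real n) / \<epsilon>" using \<Lambda>_le \<epsilon> by (intro divide_right_mono) auto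
    then show ?thesis using m_le by simp
  qed
  moreover have "eps_tester n \<epsilon> P (erasure_adversary n t) ?T" "eps_tester n \<epsilon> P (corruption_adversary n t) ?T"
    unfolding eps_tester_def erasure_adversary_def corruption_adversary_def
    using queries_in_two_phase_tester[OF ms m0]
      two_phase_tester_accepts[OF _ _ t(1) ms m0 alt[unfolded \<Lambda>_def]]
      two_phase_tester_rejects[OF _ _ t(1) ms m0 alt[unfolded \<Lambda>_def] P _ L6 Ln L_le enough[unfolded \<Lambda>_def]] by blast+
  ultimately show ?thesis
    using makes_at_most_queries_two_phase_tester two_phase_tester_one_sided[OF ms m0] by blast
qed

section \<open>Hard inputs and the hiding adversary\<close>

definition block :: "nat \<Rightarrow> nat \<Rightarrow> nat" where
  "block w x = (x - 1) div w"

definition offset :: "nat \<Rightarrow> nat \<Rightarrow> nat" where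
  "offset w x = (x - 1) mod w"

text \<open>A block is special if its secret \<open>s\<close> is below \<open>w\<close>. It is then constant in the sorted input and a
  cyclic shift of a decreasing run in the far one; for uniform \<open>s\<close> both have the same distribution
  at any single position.\<close>

definition cell :: "nat \<Rightarrow> bool \<Rightarrow> nat \<Rightarrow> nat \<Rightarrow> nat" where
  "cell w far s x = block w x * w +
     (if s < w then if far then (s + w - offset w x) mod w else s else 0)"

definition hard_input :: "nat \<Rightarrow> bool \<Rightarrow> (nat \<Rightarrow> nat) \<Rightarrow> nat \<Rightarrow> real" where
  "hard_input w far \<sigma> x = real (cell w far (\<sigma> (block w x)) x)"

lemma cell_bounds:
  assumes "0 < w"
  shows "block w x * w \<le> cell w far s x" "cell w far s x < block w x * w + w"
  using assms by (auto simp: cell_def)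

lemma hard_input_sorted:
  assumes "0 < w"
  shows "hard_input w False \<sigma> \<in> sortedness n"
  unfolding sortedness_def
proof (intro CollectI ballI impI)
  fix x y :: nat assume "x < y"
  then have "block w x \<le> block w y"
    unfolding block_def by (intro div_le_mono) auto
  then consider "block w x = block w y" | "block w x < block w y" by linarith
  then show "hard_input w False \<sigma> x \<le> hard_input w False \<sigma> y"
  proof cases
    case 1
    then show ?thesis by (simp add: hard_input_def cell_def)
  next
    case 2
    then have "(block w x + 1) * w \<le> block w y * w" by (intro mult_le_mono1) auto
    then have "cell w False (\<sigma> (block w x)) x \<le> cell w False (\<sigma> (block w y)) y"
      using cell_bounds(2)[OF assms, where x = x and far = False and s = "\<sigma> (block w x)"]
        cell_bounds(1)[OF assms, where x = y and far = False and s = "\<sigma> (block w y)"] by simp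
    then show ?thesis by (simp add: hard_input_def)
  qed
qed

text \<open>The shifted value falls by 1 at each position except right after offset
  \<open>s\<close>, where it wraps around. So the offsets up to \<open>s\<close> and those beyond
  form two decreasing runs.\<close>

lemma far_cell_decreasing:
  assumes "s < w" "block w x = block w y" "1 \<le> x" "x < y" "(offset w x \<le> s) = (offset w y \<le> s)"
  shows "cell w True s y < cell w True s x"
proof -
  have "offset w x < offset w y"
  proof -
    have "x - 1 = block w x * w + offset w x" "y - 1 = block w y * w + offset w y"
      by (simp_all add: block_def offset_def)
    moreover have "block w x * w = block w y * w" using assms(2) by simp
    ultimately show ?thesis using assms(3,4) by linarith
  qed
  moreover have "offset w y < w" using assms by (simp add: offset_def)
  moreover have "(s + w - q) mod w = (if q \<le> s then s - q else s + w - q)" if "q < w" for q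
  proof (cases "q \<le> s")
    case True
    then have "s + w - q = (s - q) + w" by simp
    then have "(s + w - q) mod w = (s - q) mod w" by simp
    then show ?thesis using True assms(1) by simp
  qed (use that assms(1) in auto)
  ultimately show ?thesis
    using assms by (auto simp: cell_def)
qed

text \<open>A sorted sequence meets a strictly decreasing run at most once, and the block consists
  of two such runs.\<close>

lemma card_block_agreements_le:
  assumes s: "\<sigma> j < w" and g: "g \<in> sortedness n"
  shows "card {x\<in>{1..n}. block w x = j \<and> hard_input w True \<sigma> x = g x} \<le> 2"
proof -
  let ?f = "hard_input w True \<sigma>"
  define E where "E b = {x\<in>{1..n}. block w x = j \<and> ?f x = g x \<and> (offset w x \<le> \<sigma> j) = b}" for b
  have "card (E b) \<le> Suc 0" for b
  proof -
    have *: "\<not> x < y" if "x \<in> E b" "y \<in> E b" for x y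
    proof
      assume "x < y"
      then have "cell w True (\<sigma> j) y < cell w True (\<sigma> j) x"
        using that s unfolding E_def by (intro far_cell_decreasing) auto
      then have "?f y < ?f x" using that by (simp add: E_def hard_input_def)
      moreover have "g x \<le> g y"
        using g that \<open>x < y\<close> unfolding E_def sortedness_def by auto
      ultimately show False using that by (simp add: E_def)
    qed
    have "finite (E b)" unfolding E_def by simp
    then show ?thesis
      using * by (subst card_le_Suc0_iff_eq) (auto simp: not_less intro: antisym)
  qed
  from this[of True] this[of False] have "card (E True \<union> E False) \<le> 2"
    using card_Un_le[of "E True" "E False"] by linarith
  moreover have "{x\<in>{1..n}. block w x = j \<and> ?f x = g x} \<subseteq> E True \<union> E False"
    unfolding E_def by auto
  then have "card {x\<in>{1..n}. block w x = j \<and> ?f x = g x} \<le> card (E True \<union> E False)"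
    by (intro card_mono) (simp_all add: E_def)
  ultimately show ?thesis by linarith
qed

lemma block_eq_iff:
  assumes "0 < w" "1 \<le> x"
  shows "block w x = j \<longleftrightarrow> x \<in> {j * w + 1..j * w + w}"
proof
  assume "block w x = j"
  then have "x - 1 = j * w + (x - 1) mod w" by (auto simp: block_def)
  moreover have "(x - 1) mod w < w" using assms by simp
  ultimately have "j * w + 1 \<le> x" "x \<le> j * w + w" using assms by linarith+
  then show "x \<in> {j * w + 1..j * w + w}" by simp
next
  assume "x \<in> {j * w + 1..j * w + w}"
  then have "w * j \<le> x - 1" "x - 1 < w * Suc j" using assms by (auto simp: mult.commute)
  then show "block w x = j" unfolding block_def by (rule div_nat_eqI)
qed

lemma card_block_le:
  assumes "0 < w"
  shows "card {x\<in>{1..n}. block w x = j} \<le> w"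
proof -
  have "{x\<in>{1..n}. block w x = j} \<subseteq> {j * w + 1..j * w + w}"
    using block_eq_iff[OF assms] by fastforce
  then have "card {x\<in>{1..n}. block w x = j} \<le> card {j * w + 1..j * w + w}"
    by (intro card_mono) auto
  then show ?thesis by simp
qed

lemma block_cells:
  assumes "0 < w" "j < n div w"
  shows "{x\<in>{1..n}. block w x = j} = {j * w + 1..j * w + w}"
proof -
  have "(j + 1) * w \<le> n div w * w" using assms by (intro mult_le_mono1) auto
  also have "\<dots> \<le> n" by simp
  finally have le: "j * w + w \<le> n" by simp
  show ?thesis
  proof (intro equalityI subsetI)
    fix x assume "x \<in> {x\<in>{1..n}. block w x = j}"
    then show "x \<in> {j * w + 1..j * w + w}" using block_eq_iff[OF assms(1)] by auto
  next
    fix x assume x: "x \<in> {j * w + 1..j * w + w}"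
    then have "1 \<le> x" "x \<le> n" using le by auto
    then show "x \<in> {x\<in>{1..n}. block w x = j}" using x block_eq_iff[OF assms(1)] by auto
  qed
qed

lemma hard_input_far:
  assumes w: "2 \<le> w"
    and many: "\<epsilon> * real n \<le> real ((w - 2) * card {j. j < n div w \<and> \<sigma> j < w})"
  shows "eps_far n \<epsilon> (sortedness n) (hard_input w True \<sigma>)"
  unfolding eps_far_def
proof
  fix g assume g: "g \<in> sortedness n"
  let ?f = "hard_input w True \<sigma>" and ?J = "{j. j < n div w \<and> \<sigma> j < w}"
  let ?D = "\<lambda>j. {x\<in>{1..n}. block w x = j \<and> ?f x \<noteq> g x}"
  have "w - 2 \<le> card (?D j)" if j: "j \<in> ?J" for j
  proof -
    have "w = card {x\<in>{1..n}. block w x = j}"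
      using j w by (subst block_cells) auto
    also have "{x\<in>{1..n}. block w x = j} = ?D j \<union> {x\<in>{1..n}. block w x = j \<and> ?f x = g x}" by auto
    also have "card \<dots> \<le> card (?D j) + card {x\<in>{1..n}. block w x = j \<and> ?f x = g x}"
      by (rule card_Un_le)
    finally show ?thesis using card_block_agreements_le[OF _ g, of \<sigma> j w] j by auto
  qed
  then have "card ?J * (w - 2) \<le> (\<Sum>j\<in>?J. card (?D j))"
    using sum_mono[of ?J "\<lambda>_. w - 2" "\<lambda>j. card (?D j)"] by simp
  also have "\<dots> = card (\<Union>j\<in>?J. ?D j)"
    by (subst card_UN_disjoint) auto
  also have "\<dots> \<le> Dist n ?f g"
    unfolding Dist_def by (intro card_mono) auto
  finally have "real ((w - 2) * card ?J) \<le> real (Dist n ?f g)"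
    by (simp only: of_nat_le_iff mult.commute)
  with many show "\<epsilon> * real n \<le> real (Dist n ?f g)" by linarith
qed

text \<open>After the first query to a special block, its other positions are covered: by \<^const>\<open>None\<close> for
  erasures, and by the value just revealed for corruptions.\<close>

definition shown :: "nat \<Rightarrow> bool \<Rightarrow> (real \<Rightarrow> real option) \<Rightarrow> nat \<Rightarrow> nat list \<Rightarrow> nat \<Rightarrow> real option" where
  "shown w far cover s xs x = (case List.find (\<lambda>y. block w y = block w x) xs of
       None \<Rightarrow> Some (real (cell w far s x))
     | Some y \<Rightarrow> if s < w \<and> y \<noteq> x then cover (real (cell w far s y)) else Some (real (cell w far s x)))"

text \<open>The answer at \<open>x\<close> involves no secret but that of its own block, and of the
  past only the first query to that block; so secrets can be drawn when first needed.\<close>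

definition ideal_oracle :: "nat \<Rightarrow> bool \<Rightarrow> (real \<Rightarrow> real option) \<Rightarrow> (nat \<Rightarrow> nat) \<Rightarrow> strategy" where
  "ideal_oracle w far cover \<sigma> xs x = shown w far cover (\<sigma> (block w x)) xs x"

definition touched :: "nat \<Rightarrow> (nat \<Rightarrow> nat) \<Rightarrow> nat list \<Rightarrow> nat set" where
  "touched w \<sigma> xs = {j \<in> block w ` set xs. \<sigma> j < w}"

text \<open>Charges \<open>w\<close> for each touched special block, at least what hiding it costs.
  The test involves only secrets of blocks already queried.\<close>

definition overspent :: "nat \<Rightarrow> real \<Rightarrow> (nat \<Rightarrow> nat) \<Rightarrow> nat list \<Rightarrow> bool" where
  "overspent w t \<sigma> xs \<longleftrightarrow> real (length xs) * t < real (w * card (touched w \<sigma> xs))"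

text \<open>The real adversary plays the ideal oracle for the latest moment at which it could afford it.
  The argument of \<open>latest\<close> is a reversed list of queries.\<close>

primrec latest :: "(nat list \<Rightarrow> bool) \<Rightarrow> nat list \<Rightarrow> nat list" where
  "latest ok [] = []"
| "latest ok (y # ys) = (if ok (rev (y # ys)) then rev (y # ys) else latest ok ys)"

definition hiding_adversary :: "nat \<Rightarrow> real \<Rightarrow> bool \<Rightarrow> (real \<Rightarrow> real option) \<Rightarrow> (nat \<Rightarrow> nat) \<Rightarrow> strategy" where
  "hiding_adversary w t far cover \<sigma> xs =
     ideal_oracle w far cover \<sigma> (latest (\<lambda>xs. \<not> overspent w t \<sigma> xs) (rev xs))"

lemma latest_eq: "ok xs \<Longrightarrow> latest ok (rev xs) = xs"
  by (cases xs rule: rev_cases) auto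

lemma latest_ok: "latest ok ys \<noteq> [] \<Longrightarrow> ok (latest ok ys)"
  by (induction ys) (auto split: if_splits)

lemma length_latest: "length (latest ok ys) \<le> length ys"
  by (induction ys) auto

lemma latest_prefix: "\<exists>zs. rev ys = latest ok ys @ zs"
proof (induction ys)
  case (Cons y ys)
  then show ?case by (cases "ok (rev (y # ys))") (auto intro: exI[of _ "_ @ [y]"])
qed simp

lemma hiding_adversary_eq_ideal:
  "\<not> overspent w t \<sigma> xs \<Longrightarrow> hiding_adversary w t far cover \<sigma> xs = ideal_oracle w far cover \<sigma> xs"
  unfolding hiding_adversary_def by (simp add: latest_eq)

lemma find_append: "List.find P (xs @ ys) = (case List.find P xs of None \<Rightarrow> List.find P ys | Some y \<Rightarrow> Some y)"
  by (induction xs) auto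

lemma ideal_oracle_Nil [simp]: "ideal_oracle w far cover \<sigma> [] x = Some (hard_input w far \<sigma> x)"
  by (simp add: ideal_oracle_def shown_def hard_input_def)

lemma hiding_adversary_Nil: "hiding_adversary w t far cover \<sigma> [] = ideal_oracle w far cover \<sigma> []"
  by (simp add: hiding_adversary_def)

lemma initial_input_hiding_adversary:
  "initial_input n (hard_input w far \<sigma>) (hiding_adversary w t far cover \<sigma>)"
  by (simp add: initial_input_def hiding_adversary_Nil)

lemma Dist_ideal_oracle_le:
  assumes "0 < w"
  shows "Dist n (ideal_oracle w far cover \<sigma> []) (ideal_oracle w far cover \<sigma> xs) \<le> w * card (touched w \<sigma> xs)"
proof -
  have fin: "finite (touched w \<sigma> xs)" by (simp add: touched_def)
  have "block w x \<in> touched w \<sigma> xs" if "ideal_oracle w far cover \<sigma> xs x \<noteq> Some (hard_input w far \<sigma> x)" for x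
  proof -
    obtain y where y: "List.find (\<lambda>y. block w y = block w x) xs = Some y" "\<sigma> (block w x) < w"
    proof (cases "List.find (\<lambda>y. block w y = block w x) xs")
      case None
      then show thesis
        using \<open>ideal_oracle w far cover \<sigma> xs x \<noteq> _\<close> by (simp add: ideal_oracle_def shown_def hard_input_def)
    next
      case (Some y)
      then have "\<sigma> (block w x) < w"
        using \<open>ideal_oracle w far cover \<sigma> xs x \<noteq> _\<close>
        by (cases "\<sigma> (block w x) < w") (auto simp: ideal_oracle_def shown_def hard_input_def)
      with Some show thesis by (rule that)
    qed
    then have "y \<in> set xs" "block w y = block w x" by (auto simp: find_Some_iff)
    then have "block w x \<in> block w ` set xs" by (metis imageI)
    with y(2) show ?thesis unfolding touched_def by simp
  qed
  then have "Dist n (ideal_oracle w far cover \<sigma> []) (ideal_oracle w far cover \<sigma> xs)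
     \<le> card (\<Union>j\<in>touched w \<sigma> xs. {x\<in>{1..n}. block w x = j})"
    unfolding Dist_def using fin by (intro card_mono) force+
  also have "\<dots> \<le> (\<Sum>j\<in>touched w \<sigma> xs. card {x\<in>{1..n}. block w x = j})"
    using fin by (rule card_UN_le)
  also have "\<dots> \<le> w * card (touched w \<sigma> xs)"
    using sum_mono[of "touched w \<sigma> xs" "\<lambda>j. card {x\<in>{1..n}. block w x = j}" "\<lambda>_. w"] card_block_le[OF assms]
    by (simp add: mult.commute)
  finally show ?thesis .
qed

lemma budget_managing_hiding_adversary:
  assumes "0 < w" "0 < t"
  shows "budget_managing n t (hiding_adversary w t far cover \<sigma>)"
  unfolding budget_managing_def
proof
  fix xs
  let ?A = "hiding_adversary w t far cover \<sigma>" and ?zs = "latest (\<lambda>xs. \<not> overspent w t \<sigma> xs) (rev xs)"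
  have "real (Dist n (?A []) (?A xs)) \<le> real (w * card (touched w \<sigma> ?zs))"
    unfolding hiding_adversary_Nil hiding_adversary_def[of w t far cover \<sigma> xs]
    using Dist_ideal_oracle_le[OF assms(1)] by (simp only: of_nat_le_iff)
  also have "\<dots> \<le> real (length ?zs) * t"
  proof (cases "?zs = []")
    case False
    then have "\<not> overspent w t \<sigma> ?zs" by (rule latest_ok)
    then show ?thesis by (simp only: overspent_def not_less)
  qed (simp add: touched_def)
  also have "\<dots> \<le> real (length xs) * t"
    using assms(2) length_latest[of _ "rev xs"] by (intro mult_right_mono) auto
  finally show "real (Dist n (?A []) (?A xs)) \<le> real (length xs) * t" .
qed

text \<open>Appending queries never changes the first query to a block, so each answer changes at
  most once, and then to \<open>None\<close>.\<close>

lemma ideal_oracle_erases: "ideal_oracle w far (\<lambda>_. None) \<sigma> (us @ vs) x \<in> {ideal_oracle w far (\<lambda>_. None) \<sigma> us x, None}"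
  unfolding ideal_oracle_def shown_def find_append by (auto split: option.split)

lemma erasure_adversary_hiding:
  assumes "0 < w" "0 < t"
  shows "erasure_adversary n t (hard_input w far \<sigma>) (hiding_adversary w t far (\<lambda>_. None) \<sigma>)"
proof -
  have "hiding_adversary w t far (\<lambda>_. None) \<sigma> (xs @ [y]) x \<in> {hiding_adversary w t far (\<lambda>_. None) \<sigma> xs x, None}" for xs y x
  proof (cases "overspent w t \<sigma> (xs @ [y])")
    case True
    then show ?thesis by (simp add: hiding_adversary_def)
  next
    case False
    let ?us = "latest (\<lambda>xs. \<not> overspent w t \<sigma> xs) (rev xs)"
    obtain zs where "rev (rev xs) = ?us @ zs" using latest_prefix by blast
    then have e: "xs @ [y] = ?us @ (zs @ [y])" by (metis append.assoc rev_rev_ident)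
    have "ideal_oracle w far (\<lambda>_. None) \<sigma> (?us @ (zs @ [y])) x \<in> {ideal_oracle w far (\<lambda>_. None) \<sigma> ?us x, None}"
      by (rule ideal_oracle_erases)
    then show ?thesis
      unfolding e[symmetric] hiding_adversary_eq_ideal[OF False] hiding_adversary_def[of _ _ _ _ _ xs] .
  qed
  then show ?thesis
    unfolding erasure_adversary_def erasing_def
    using initial_input_hiding_adversary budget_managing_hiding_adversary[OF assms] by blast
qed

lemma corruption_adversary_hiding:
  assumes "0 < w" "0 < t"
  shows "corruption_adversary n t (hard_input w far \<sigma>) (hiding_adversary w t far Some \<sigma>)"
proof -
  have "hiding_adversary w t far Some \<sigma> xs x \<noteq> None" for xs x
    by (auto simp: hiding_adversary_def ideal_oracle_def shown_def split: option.split)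
  then show ?thesis
    unfolding corruption_adversary_def corrupting_def
    using initial_input_hiding_adversary budget_managing_hiding_adversary[OF assms] by blast
qed

section \<open>Indistinguishability\<close>

lemma integrable_pmf_of: "integrable (measure_pmf M) (\<lambda>x. pmf (f x) i)"
  by (rule measure_pmf.integrable_const_bound[where B = 1]) (auto simp: pmf_le_1)

lemma pmf_bind_mono:
  assumes "\<And>x. pmf (f x) i \<le> pmf (g x) j"
  shows "pmf (bind_pmf M f) i \<le> pmf (bind_pmf M g) j"
  unfolding pmf_bind by (intro integral_mono integrable_pmf_of assms)

lemma pmf_bind_le_add:
  assumes "\<And>x. pmf (f x) i \<le> pmf (g x) j + pmf (g x) k"
  shows "pmf (bind_pmf M f) i \<le> pmf (bind_pmf M g) j + pmf (bind_pmf M g) k"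
proof -
  have "pmf (bind_pmf M f) i \<le> (\<integral>x. pmf (g x) j + pmf (g x) k \<partial>M)"
    unfolding pmf_bind by (intro integral_mono Bochner_Integration.integrable_add integrable_pmf_of assms)
  then show ?thesis
    unfolding pmf_bind by (simp add: Bochner_Integration.integral_add integrable_pmf_of)
qed

lemma pmf_bind_le_const:
  assumes "\<And>x. x \<in> set_pmf M \<Longrightarrow> pmf (f x) i \<le> c"
  shows "pmf (bind_pmf M f) i \<le> c"
proof -
  have "pmf (bind_pmf M f) i \<le> (\<integral>x. c \<partial>M)"
    unfolding pmf_bind by (intro integral_mono_AE integrable_pmf_of) (auto simp: AE_measure_pmf_iff assms)
  then show ?thesis by simp
qed

lemma pmf_run_Suc_mono: "pmf (run T A k h) (Some v) \<le> pmf (run T A (Suc k) h) (Some v)"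
proof (induction k arbitrary: h)
  case (Suc k)
  show ?case
    by (subst (1 2) run.simps(2), rule pmf_bind_mono)
      (use Suc in \<open>auto simp del: run.simps split: action.split prod.split\<close>)
qed simp

lemma pmf_run_mono: "k \<le> k' \<Longrightarrow> pmf (run T A k h) (Some v) \<le> pmf (run T A k' h) (Some v)"
  by (rule lift_Suc_mono_le[of "\<lambda>k. pmf (run T A k h) (Some v)"]) (rule pmf_run_Suc_mono)

text \<open>The outcome \<^const>\<open>None\<close> means that the adversary has overspent its budget.\<close>

primrec stopped_run ::
  "tester \<Rightarrow> strategy \<Rightarrow> (nat list \<Rightarrow> bool) \<Rightarrow> nat \<Rightarrow> history \<Rightarrow> bool option option pmf" where
  "stopped_run T A b 0 h = return_pmf (Some None)"
| "stopped_run T A b (Suc k) h = (if b (queries h) then return_pmf None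
     else bind_pmf (T h) (\<lambda>(r, a). case a of
         Accept \<Rightarrow> return_pmf (Some (Some True))
       | Reject \<Rightarrow> return_pmf (Some (Some False))
       | Query x \<Rightarrow> stopped_run T A b k (h @ [(r, x, A (queries h) x)])))"

text \<open>The two runs coincide until the budget is first exceeded, and that event is the outcome
  \<open>None\<close>.\<close>

lemma pmf_run_le_stopped_run:
  assumes "\<And>xs. \<not> b xs \<Longrightarrow> A xs = I xs"
  shows "pmf (run T A k h) (Some v)
    \<le> pmf (stopped_run T I b k h) (Some (Some v)) + pmf (stopped_run T I b k h) None"
proof (induction k arbitrary: h)
  case (Suc k)
  show ?case
  proof (cases "b (queries h)")
    case True
    then show ?thesis by (simp add: pmf_le_1)
  next
    case False
    have "pmf (run T A (Suc k) h) (Some v)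
      \<le> pmf (bind_pmf (T h) (\<lambda>(r, a). case a of
         Accept \<Rightarrow> return_pmf (Some (Some True))
       | Reject \<Rightarrow> return_pmf (Some (Some False))
       | Query x \<Rightarrow> stopped_run T I b k (h @ [(r, x, I (queries h) x)]))) (Some (Some v))
       + pmf (bind_pmf (T h) (\<lambda>(r, a). case a of
         Accept \<Rightarrow> return_pmf (Some (Some True))
       | Reject \<Rightarrow> return_pmf (Some (Some False))
       | Query x \<Rightarrow> stopped_run T I b k (h @ [(r, x, I (queries h) x)]))) None"
      unfolding run.simps
      by (rule pmf_bind_le_add) (use Suc assms[OF False] in \<open>auto simp: indicator_def split: action.split\<close>)
    with False show ?thesis by simp
  qed
qed simp

section \<open>Deferred drawing of the secrets\<close>

definition resample :: "nat pmf \<Rightarrow> nat set \<Rightarrow> (nat \<Rightarrow> nat) \<Rightarrow> (nat \<Rightarrow> nat) pmf" where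
  "resample U J \<tau> = map_pmf (\<lambda>\<rho> j. if j \<in> J then \<rho> j else \<tau> j) (Pi_pmf J 0 (\<lambda>_. U))"

lemma resample_insert:
  assumes "finite J" "j \<notin> J"
  shows "resample U (insert j J) \<tau> = bind_pmf U (\<lambda>s. resample U J (\<tau>(j := s)))"
proof -
  have "(\<lambda>i. if i \<in> insert j J then (\<rho>(j := s)) i else \<tau> i) = (\<lambda>i. if i \<in> J then \<rho> i else (\<tau>(j := s)) i)" for \<rho> s
    using assms(2) by auto
  then show ?thesis
    unfolding resample_def Pi_pmf_insert'[OF assms] map_bind_pmf map_return_pmf
    by (simp add: map_pmf_def)
qed

lemma resample_remove:
  "finite J \<Longrightarrow> j \<in> J \<Longrightarrow> resample U J \<tau> = bind_pmf U (\<lambda>s. resample U (J - {j}) (\<tau>(j := s)))"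
  using resample_insert[of "J - {j}" j U \<tau>] by (simp add: insert_absorb)

lemma resample_outside: "\<sigma> \<in> set_pmf (resample U J \<tau>) \<Longrightarrow> j \<notin> J \<Longrightarrow> \<sigma> j = \<tau> j"
  by (auto simp: resample_def)

lemma touched_cong: "(\<And>j. j \<in> block w ` set xs \<Longrightarrow> \<sigma> j < w \<longleftrightarrow> \<tau> j < w) \<Longrightarrow> touched w \<sigma> xs = touched w \<tau> xs"
  unfolding touched_def by auto

text \<open>\<open>J\<close> holds the blocks whose secrets are still open, independent with law
  \<open>U\<close>; \<open>\<tau>\<close> fixes all others.\<close>

definition averaged_run ::
  "nat \<Rightarrow> real \<Rightarrow> bool \<Rightarrow> (real \<Rightarrow> real option) \<Rightarrow> nat pmf \<Rightarrow> tester \<Rightarrow> nat set \<Rightarrow> (nat \<Rightarrow> nat) \<Rightarrow> nat \<Rightarrow> history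
     \<Rightarrow> bool option option pmf" where
  "averaged_run w t far cover U T J \<tau> k h = bind_pmf (resample U J \<tau>)
     (\<lambda>\<sigma>. stopped_run T (ideal_oracle w far cover \<sigma>) (overspent w t \<sigma>) k h)"

lemma averaged_run_0: "averaged_run w t far cover U T J \<tau> 0 h = return_pmf (Some None)"
  by (simp add: averaged_run_def)

text \<open>Drawing all secrets in advance is the same as drawing each at the first query to its
  block, since until then neither the answers nor the budget test involve it.\<close>

lemma averaged_run_Suc:
  assumes J: "finite J" "J \<inter> block w ` set (queries h) = {}"
  shows "averaged_run w t far cover U T J \<tau> (Suc k) h =
    (if overspent w t \<tau> (queries h) then return_pmf None
     else bind_pmf (T h) (\<lambda>(r, a). case a of
         Accept \<Rightarrow> return_pmf (Some (Some True))
       | Reject \<Rightarrow> return_pmf (Some (Some False))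
       | Query x \<Rightarrow> if block w x \<in> J
           then bind_pmf U (\<lambda>s. averaged_run w t far cover U T (J - {block w x}) (\<tau>(block w x := s)) k
             (h @ [(r, x, Some (real (cell w far s x)))]))
           else averaged_run w t far cover U T J \<tau> k (h @ [(r, x, shown w far cover (\<tau> (block w x)) (queries h) x)])))"
    (is "_ = (if _ then _ else bind_pmf _ ?step)")
proof -
  let ?xs = "queries h"
  let ?run = "\<lambda>\<sigma>. stopped_run T (ideal_oracle w far cover \<sigma>) (overspent w t \<sigma>)"
  have eq: "overspent w t \<sigma> ?xs = overspent w t \<tau> ?xs" if "\<sigma> \<in> set_pmf (resample U J \<tau>)" for \<sigma>
  proof -
    have "touched w \<sigma> ?xs = touched w \<tau> ?xs"
    proof (rule touched_cong)
      fix j assume "j \<in> block w ` set ?xs"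
      then have "j \<notin> J" using J by blast
      with resample_outside[OF that] show "\<sigma> j < w \<longleftrightarrow> \<tau> j < w" by simp
    qed
    then show ?thesis by (simp add: overspent_def)
  qed
  show ?thesis
  proof (cases "overspent w t \<tau> ?xs")
    case True
    have "averaged_run w t far cover U T J \<tau> (Suc k) h = bind_pmf (resample U J \<tau>) (\<lambda>_. return_pmf None)"
      unfolding averaged_run_def using eq True by (intro bind_pmf_cong refl) simp
    with True show ?thesis by simp
  next
    case False
    let ?f = "\<lambda>\<sigma> (r, a). case a of
         Accept \<Rightarrow> return_pmf (Some (Some True))
       | Reject \<Rightarrow> return_pmf (Some (Some False))
       | Query x \<Rightarrow> ?run \<sigma> k (h @ [(r, x, ideal_oracle w far cover \<sigma> ?xs x)])"
    have "averaged_run w t far cover U T J \<tau> (Suc k) h = bind_pmf (resample U J \<tau>) (\<lambda>\<sigma>. bind_pmf (T h) (?f \<sigma>))"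
      unfolding averaged_run_def using eq False by (intro bind_pmf_cong refl) simp
    also have "\<dots> = bind_pmf (T h) (\<lambda>ra. bind_pmf (resample U J \<tau>) (\<lambda>\<sigma>. ?f \<sigma> ra))"
      by (rule bind_commute_pmf)
    also have "\<dots> = bind_pmf (T h) ?step"
    proof (rule bind_pmf_cong[OF refl])
      fix ra :: "nat \<times> action"
      obtain r a where ra: "ra = (r, a)" by (cases ra)
      have "bind_pmf (resample U J \<tau>) (\<lambda>\<sigma>. ?f \<sigma> (r, a)) = ?step (r, a)"
      proof (cases a)
        case (Query x)
        let ?j = "block w x"
        show ?thesis
        proof (cases "?j \<in> J")
          case True
          then have none: "List.find (\<lambda>y. block w y = ?j) ?xs = None"
            using J unfolding find_None_iff by (metis disjoint_iff image_eqI)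
          have "bind_pmf (resample U J \<tau>) (\<lambda>\<sigma>. ?f \<sigma> (r, a)) =
            bind_pmf U (\<lambda>s. bind_pmf (resample U (J - {?j}) (\<tau>(?j := s))) (\<lambda>\<sigma>. ?f \<sigma> (r, a)))"
            by (subst resample_remove[OF J(1) True]) (simp add: bind_assoc_pmf)
          also have "\<dots> = ?step (r, a)"
            unfolding Query using True
            by (auto simp: averaged_run_def ideal_oracle_def shown_def none resample_outside
                intro!: bind_pmf_cong)
          finally show ?thesis .
        next
          case False
          then show ?thesis
            unfolding Query by (auto simp: averaged_run_def ideal_oracle_def resample_outside intro!: bind_pmf_cong)
        qed
      qed simp_all
      then show "bind_pmf (resample U J \<tau>) (\<lambda>\<sigma>. ?f \<sigma> ra) = ?step ra"
        unfolding ra .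
    qed
    finally show ?thesis using False by simp
  qed
qed

lemma queries_snoc [simp]: "queries (h @ [(r, x, a)]) = queries h @ [x]"
  by (simp add: queries_def)

lemma mod_add_mod_diff:
  fixes s q w :: nat
  assumes "q < w" "s < w"
  shows "((s + q) mod w + w - q) mod w = s"
proof (cases "s + q < w")
  case False
  then have "(s + q) mod w = s + q - w" using assms by (simp add: mod_if)
  then show ?thesis using False assms by simp
qed (use assms in simp)

text \<open>For \<open>q\<close> the offset of the first query to a block, this relabels the secrets
  so that the far cell there equals the sorted one; being a bijection, it preserves the uniform
  law.\<close>

lemma bij_betw_cyclic_shift:
  fixes w :: nat
  assumes "q < w" "w \<le> N"
  shows "bij_betw (\<lambda>s. if s < w then (s + q) mod w else s) {..<N} {..<N}"
proof -
  let ?\<pi> = "\<lambda>s. if s < w then (s + q) mod w else s"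
  have w: "0 < w" using assms by simp
  have "inj_on ?\<pi> {..<N}"
  proof (rule inj_onI)
    fix s s' assume eq: "?\<pi> s = ?\<pi> s'"
    have "?\<pi> s < w \<longleftrightarrow> s < w" "?\<pi> s' < w \<longleftrightarrow> s' < w" using w by simp_all
    then have iff: "s < w \<longleftrightarrow> s' < w" using eq by simp
    show "s = s'"
    proof (cases "s < w")
      case True
      then have "(s + q) mod w = (s' + q) mod w" using eq iff by simp
      then show ?thesis
        using mod_add_mod_diff[OF assms(1), of s] mod_add_mod_diff[OF assms(1), of s'] True iff by metis
    qed (use eq iff in simp)
  qed
  moreover have "?\<pi> ` {..<N} \<subseteq> {..<N}"
    using w \<open>w \<le> N\<close> by (auto intro: less_le_trans[OF mod_less_divisor])
  ultimately show "bij_betw ?\<pi> {..<N} {..<N}"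
    unfolding bij_betw_def using endo_inj_surj[OF finite_lessThan] by blast
qed

text \<open>A coupling: fixed blocks may carry different secrets in the two worlds, but the same
  ones are special, and there the cells at the first query agree. Every later answer in a special
  block is computed from that cell alone.\<close>

lemma averaged_run_far_eq:
  assumes w: "0 < w" "w \<le> N" and U: "U = pmf_of_set {..<N}"
    and "finite J" "J \<inter> block w ` set (queries h) = {}"
    and "\<And>j. j \<notin> J \<Longrightarrow> (\<tau> j < w \<longleftrightarrow> \<tau>' j < w) \<and> (\<tau> j < w \<longrightarrow>
      (\<exists>y. List.find (\<lambda>y. block w y = j) (queries h) = Some y \<and> cell w False (\<tau> j) y = cell w True (\<tau>' j) y))"
  shows "averaged_run w t False cover U T J \<tau> k h = averaged_run w t True cover U T J \<tau>' k h"
  using assms(4-6)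
proof (induction k arbitrary: h J \<tau> \<tau>')
  case 0
  then show ?case by (simp add: averaged_run_0)
next
  case (Suc k)
  let ?xs = "queries h"
  note J = Suc.prems(1,2) and rel = Suc.prems(3)
  have "touched w \<tau> ?xs = touched w \<tau>' ?xs"
    using rel J(2) by (intro touched_cong) blast
  then have over: "overspent w t \<tau> ?xs = overspent w t \<tau>' ?xs" by (simp add: overspent_def)
  have new: "bind_pmf U (\<lambda>s. averaged_run w t False cover U T (J - {block w x}) (\<tau>(block w x := s)) k
             (h @ [(r, x, Some (real (cell w False s x)))]))
    = bind_pmf U (\<lambda>s. averaged_run w t True cover U T (J - {block w x}) (\<tau>'(block w x := s)) k
             (h @ [(r, x, Some (real (cell w True s x)))]))"
    if x: "block w x \<in> J" for r x
  proof -
    \<comment> \<open>The far cell at \<open>x\<close> subtracts the offset modulo \<open>w\<close>,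
      so adding it first restores \<open>s\<close>.\<close>
    define \<pi> where "\<pi> s = (if s < w then (s + offset w x) mod w else s)" for s
    have q: "offset w x < w" using w by (simp add: offset_def)
    have "map_pmf \<pi> U = U"
      unfolding U using bij_betw_cyclic_shift[OF q w(2)] w
      by (intro map_pmf_of_set_bij_betw) (auto simp: \<pi>_def[abs_def] lessThan_empty_iff)
    then have shift: "bind_pmf U g = bind_pmf U (\<lambda>s. g (\<pi> s))" for g :: "nat \<Rightarrow> bool option option pmf"
      using bind_map_pmf[of \<pi> U g] by (simp add: o_def)
    have "bind_pmf U (\<lambda>s. averaged_run w t True cover U T (J - {block w x}) (\<tau>'(block w x := s)) k
             (h @ [(r, x, Some (real (cell w True s x)))]))
      = bind_pmf U (\<lambda>s. averaged_run w t True cover U T (J - {block w x}) (\<tau>'(block w x := \<pi> s)) k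
             (h @ [(r, x, Some (real (cell w True (\<pi> s) x)))]))"
      by (rule shift)
    also have "\<dots> = bind_pmf U (\<lambda>s. averaged_run w t False cover U T (J - {block w x}) (\<tau>(block w x := s)) k
             (h @ [(r, x, Some (real (cell w False s x)))]))"
    proof (intro bind_pmf_cong refl)
      fix s
      have \<pi>: "\<pi> s < w \<longleftrightarrow> s < w" and cell: "cell w True (\<pi> s) x = cell w False s x"
        using w mod_add_mod_diff[OF q] by (auto simp: \<pi>_def cell_def)
      have none: "List.find (\<lambda>y. block w y = block w x) ?xs = None"
        using J x unfolding find_None_iff by (metis disjoint_iff image_eqI)
      show "averaged_run w t True cover U T (J - {block w x}) (\<tau>'(block w x := \<pi> s)) k
             (h @ [(r, x, Some (real (cell w True (\<pi> s) x)))])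
        = averaged_run w t False cover U T (J - {block w x}) (\<tau>(block w x := s)) k
             (h @ [(r, x, Some (real (cell w False s x)))])"
        unfolding cell
      proof (rule Suc.IH[symmetric])
        fix j assume j: "j \<notin> J - {block w x}"
        show "((\<tau>(block w x := s)) j < w \<longleftrightarrow> (\<tau>'(block w x := \<pi> s)) j < w) \<and> ((\<tau>(block w x := s)) j < w \<longrightarrow>
          (\<exists>y. List.find (\<lambda>y. block w y = j) (queries (h @ [(r, x, Some (real (cell w False s x)))])) = Some y \<and>
            cell w False ((\<tau>(block w x := s)) j) y = cell w True ((\<tau>'(block w x := \<pi> s)) j) y))"
        proof (cases "j = block w x")
          case True
          then show ?thesis using \<pi> cell none by (simp add: find_append)
        next
          case False
          then have "j \<notin> J" using j by blast
          with rel[OF this] False show ?thesis by (auto simp: find_append)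
        qed
      qed (use J in auto)
    qed
    finally show ?thesis by (rule sym)
  qed
  have old: "averaged_run w t False cover U T J \<tau> k (h @ [(r, x, shown w False cover (\<tau> (block w x)) ?xs x)])
    = averaged_run w t True cover U T J \<tau>' k (h @ [(r, x, shown w True cover (\<tau>' (block w x)) ?xs x)])"
    if x: "block w x \<notin> J" for r x
  proof -
    have "shown w False cover (\<tau> (block w x)) ?xs x = shown w True cover (\<tau>' (block w x)) ?xs x"
      using rel[OF x] by (auto simp: shown_def cell_def split: option.split)
    moreover have "averaged_run w t False cover U T J \<tau> k (h @ [(r, x, a)]) = averaged_run w t True cover U T J \<tau>' k (h @ [(r, x, a)])" for a
    proof (rule Suc.IH)
      fix j assume "j \<notin> J"
      from rel[OF this] show "(\<tau> j < w \<longleftrightarrow> \<tau>' j < w) \<and> (\<tau> j < w \<longrightarrow>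
        (\<exists>y. List.find (\<lambda>y. block w y = j) (queries (h @ [(r, x, a)])) = Some y \<and> cell w False (\<tau> j) y = cell w True (\<tau>' j) y))"
        by (auto simp: find_append)
    qed (use J x in auto)
    ultimately show ?thesis by simp
  qed
  show ?case
    unfolding averaged_run_Suc[OF J] over using new old
    by (auto intro!: bind_pmf_cong split: action.split)
qed

text \<open>\<open>Z X i\<close> bounds the chance of ever overspending from a state with
  \<open>X\<close> touched special blocks after \<open>i\<close> queries. A query to an old block
  only lets time pass (\<open>Z_Suc\<close>); a new open block is special with probability
  \<open>w / N\<close> (\<open>Z_step\<close>). The bound is uniform in \<open>k\<close>, so it
  covers testers without a query limit.\<close>

lemma prob_overspent_le:
  fixes Z :: "nat \<Rightarrow> nat \<Rightarrow> real"
  assumes w: "0 < w" "w \<le> N" and U: "U = pmf_of_set {..<N}"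
    and Z_pos: "\<And>X i. 0 \<le> Z X i"
    and Z_Suc: "\<And>X i. Z X (Suc i) \<le> Z X i"
    and Z_step: "\<And>X i. real (N - w) * Z X (Suc i) + real w * Z (Suc X) (Suc i) \<le> real N * Z X i"
    and Z_over: "\<And>X i. real i * t < real (w * X) \<Longrightarrow> 1 \<le> Z X i"
    and "finite J" "J \<inter> block w ` set (queries h) = {}"
    and "\<And>j. j \<notin> J \<Longrightarrow> \<tau> j < w \<Longrightarrow> j \<in> block w ` set (queries h)"
  shows "pmf (averaged_run w t far cover U T J \<tau> k h) None \<le> Z (card (touched w \<tau> (queries h))) (length (queries h))"
  using assms(8-10)
proof (induction k arbitrary: h J \<tau>)
  case 0
  then show ?case using Z_pos by (simp add: averaged_run_0)
next
  case (Suc k)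
  let ?xs = "queries h"
  let ?Z = "\<lambda>\<tau> xs. Z (card (touched w \<tau> xs)) (length xs)"
  note J = Suc.prems(1,2) and out = Suc.prems(3)
  show ?case
  proof (cases "overspent w t \<tau> ?xs")
    case True
    then show ?thesis
      using Z_over unfolding averaged_run_Suc[OF J] by (simp add: overspent_def)
  next
    case False
    have old: "pmf (averaged_run w t far cover U T J \<tau> k (h @ [(r, x, a)])) None \<le> ?Z \<tau> ?xs"
      if x: "block w x \<notin> J" for r x a
    proof -
      have "touched w \<tau> (?xs @ [x]) = touched w \<tau> ?xs"
        using out[OF x] by (auto simp: touched_def)
      then have "pmf (averaged_run w t far cover U T J \<tau> k (h @ [(r, x, a)])) None
        \<le> Z (card (touched w \<tau> ?xs)) (Suc (length ?xs))"
        using Suc.IH[of J "h @ [(r, x, a)]" \<tau>] J out x by simp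
      also have "\<dots> \<le> ?Z \<tau> ?xs" by (rule Z_Suc)
      finally show ?thesis .
    qed
    have new: "pmf (bind_pmf U (\<lambda>s. averaged_run w t far cover U T (J - {block w x}) (\<tau>(block w x := s)) k
             (h @ [(r, x, Some (real (cell w far s x)))]))) None \<le> ?Z \<tau> ?xs" (is "pmf (bind_pmf U ?f) None \<le> _")
      if x: "block w x \<in> J" for r x
    proof -
      let ?X = "card (touched w \<tau> ?xs)" and ?i = "length ?xs"
      have nt: "block w x \<notin> block w ` set ?xs" using x J by blast
      have le: "pmf (?f s) None \<le> (if s < w then Z (Suc ?X) (Suc ?i) else Z ?X (Suc ?i))" for s
      proof -
        have "touched w (\<tau>(block w x := s)) (?xs @ [x]) =
          (if s < w then insert (block w x) (touched w \<tau> ?xs) else touched w \<tau> ?xs)"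
          using nt by (auto simp: touched_def image_iff)
        moreover have "block w x \<notin> touched w \<tau> ?xs" "finite (touched w \<tau> ?xs)"
          using nt by (auto simp: touched_def image_iff)
        moreover have "pmf (?f s) None \<le> ?Z (\<tau>(block w x := s)) (?xs @ [x])"
        proof -
          let ?h = "h @ [(r, x, Some (real (cell w far s x)))]"
          have "pmf (?f s) None \<le> ?Z (\<tau>(block w x := s)) (queries ?h)"
          proof (rule Suc.IH)
            show "(J - {block w x}) \<inter> block w ` set (queries ?h) = {}" using J by auto
            fix j assume "j \<notin> J - {block w x}" "(\<tau>(block w x := s)) j < w"
            then show "j \<in> block w ` set (queries ?h)"
              using out[of j] by (cases "j = block w x") auto
          qed (use J in simp)
          then show ?thesis by simp
        qed
        ultimately show ?thesis by (simp split: if_splits)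
      qed
      have N: "0 < N" using w by simp
      have "(\<Sum>s<N. pmf (?f s) None) \<le> (\<Sum>s<N. if s < w then Z (Suc ?X) (Suc ?i) else Z ?X (Suc ?i))"
        by (intro sum_mono le)
      also have "\<dots> = real (N - w) * Z ?X (Suc ?i) + real w * Z (Suc ?X) (Suc ?i)"
      proof -
        have "{..<N} \<inter> {s. s < w} = {..<w}" "{..<N} \<inter> - {s. s < w} = {w..<N}" using w by auto
        then show ?thesis by (simp add: sum.If_cases)
      qed
      also have "\<dots> \<le> real N * Z ?X ?i" by (rule Z_step)
      finally have "(\<Sum>s<N. pmf (?f s) None) / real N \<le> Z ?X ?i"
        using N by (simp only: divide_le_eq of_nat_0_less_iff if_True mult.commute)
      moreover have "pmf (bind_pmf U ?f) None = (\<Sum>s<N. pmf (?f s) None) / real N"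
        using N unfolding U by (subst pmf_bind_pmf_of_set) (auto simp: lessThan_empty_iff)
      ultimately show ?thesis by (simp only:)
    qed
    show ?thesis
      unfolding averaged_run_Suc[OF J] if_not_P[OF False]
    proof (rule pmf_bind_le_const, clarify)
      fix r a
      show "pmf (case a of
         Accept \<Rightarrow> return_pmf (Some (Some True))
       | Reject \<Rightarrow> return_pmf (Some (Some False))
       | Query x \<Rightarrow> if block w x \<in> J
           then bind_pmf U (\<lambda>s. averaged_run w t far cover U T (J - {block w x}) (\<tau>(block w x := s)) k
             (h @ [(r, x, Some (real (cell w far s x)))]))
           else averaged_run w t far cover U T J \<tau> k (h @ [(r, x, shown w far cover (\<tau> (block w x)) ?xs x)])) None
        \<le> ?Z \<tau> ?xs"
        using new old Z_pos by (cases a) simp_all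
    qed
  qed
qed

text \<open>The exponential moment method with parameter 1: as \<open>exp (- 1) \<le> 1 / 2\<close>,
  each of the \<open>M\<close> factors has mean at most \<open>1 - w / (2 * N)\<close>.\<close>

lemma prob_few_special_le:
  fixes m :: real
  assumes w: "0 < w" "w \<le> N"
  shows "measure_pmf.prob (Pi_pmf {..<M} d (\<lambda>_. pmf_of_set {..<N})) {\<sigma>. real (card {j. j < M \<and> \<sigma> j < w}) < m}
    \<le> exp (m - real M * real w / (2 * real N))"
proof -
  let ?D = "Pi_pmf {..<M} d (\<lambda>_. pmf_of_set {..<N})" and ?X = "\<lambda>\<sigma>. real (card {j. j < M \<and> \<sigma> j < w})"
  let ?f = "\<lambda>s. exp (- of_bool (s < w)) :: real"
  have N: "0 < N" using w by simp
  have prod: "exp (- ?X \<sigma>) = (\<Prod>j<M. ?f (\<sigma> j))" for \<sigma>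
  proof -
    have "?X \<sigma> = (\<Sum>j<M. of_bool (\<sigma> j < w))" by (simp add: Int_def)
    then show ?thesis by (simp add: exp_sum[symmetric] sum_negf)
  qed
  have "measure_pmf.prob ?D {\<sigma>. ?X \<sigma> < m} = (\<integral>\<sigma>. indicator {\<sigma>. ?X \<sigma> < m} \<sigma> \<partial>?D)" by simp
  also have "\<dots> \<le> (\<integral>\<sigma>. exp m * exp (- ?X \<sigma>) \<partial>?D)"
  proof (rule integral_mono)
    show "integrable ?D (\<lambda>\<sigma>. exp m * exp (- ?X \<sigma>))"
      by (rule measure_pmf.integrable_const_bound[where B = "exp m"]) auto
    show "integrable ?D (indicator {\<sigma>. ?X \<sigma> < m} :: _ \<Rightarrow> real)"
      by (rule measure_pmf.integrable_const_bound[where B = 1]) auto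
    show "indicator {\<sigma>. ?X \<sigma> < m} \<sigma> \<le> exp m * exp (- ?X \<sigma>)" for \<sigma>
      by (auto simp: indicator_def exp_add[symmetric])
  qed
  also have "\<dots> = exp m * (\<integral>\<sigma>. (\<Prod>j<M. ?f (\<sigma> j)) \<partial>?D)"
    unfolding prod by simp
  also have "(\<integral>\<sigma>. (\<Prod>j<M. ?f (\<sigma> j)) \<partial>?D) = (\<Prod>j<M. \<integral>s. ?f s \<partial>pmf_of_set {..<N})"
    by (rule expectation_prod_Pi_pmf)
      (auto intro!: measure_pmf.integrable_const_bound[where B = 1])
  also have "(\<integral>s. ?f s \<partial>pmf_of_set {..<N}) = (\<Sum>s<N. ?f s) / real N"
    using N by (subst integral_pmf_of_set) (auto simp: lessThan_empty_iff)
  also have "(\<Sum>s<N. ?f s) = real w * exp (- 1) + real (N - w)"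
  proof -
    have "(\<Sum>s<N. ?f s) = (\<Sum>s<N. if s < w then exp (- 1) else 1)" by (intro sum.cong) auto
    moreover have "{..<N} \<inter> {s. s < w} = {..<w}" "{..<N} \<inter> - {s. s < w} = {w..<N}" using w by auto
    ultimately show ?thesis by (simp add: sum.If_cases)
  qed
  also have "exp m * (\<Prod>j<M. (real w * exp (- 1) + real (N - w)) / real N)
    \<le> exp m * (\<Prod>j<M. exp (- (real w / (2 * real N))))"
  proof (intro mult_left_mono prod_mono conjI)
    have "exp (- 1) \<le> (1 / 2 :: real)"
      using exp_ge_add_one_self[of 1] by (simp add: exp_minus field_simps)
    then have "real w * exp (- 1) \<le> real w * (1 / 2)" by (intro mult_left_mono) auto
    then have "(real w * exp (- 1) + real (N - w)) / real N \<le> 1 - real w / (2 * real N)"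
      using N w by (simp add: field_simps of_nat_diff)
    also have "\<dots> \<le> exp (- (real w / (2 * real N)))"
      using exp_ge_add_one_self[of "- (real w / (2 * real N))"] by simp
    finally show "(real w * exp (- 1) + real (N - w)) / real N \<le> exp (- (real w / (2 * real N)))" .
  qed auto
  also have "\<dots> = exp (m - real M * real w / (2 * real N))"
    by (simp add: exp_of_nat_mult[symmetric] exp_add[symmetric])
  finally show ?thesis .
qed

section \<open>The contradiction for a hypothetical tester\<close>

lemma eventually_verdict:
  assumes "c < verdict_prob T A v"
  shows "\<forall>\<^sub>F k in sequentially. c \<le> pmf (run T A k []) (Some v)"
proof -
  obtain k where k: "c < pmf (run T A k []) (Some v)"
    using assms unfolding verdict_prob_def less_cSUP_iff[OF UNIV_not_empty bdd_above_pmf] by blast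
  show ?thesis
    by (rule eventually_sequentiallyI[of k])
      (use k pmf_run_mono[of k _ T A "[]" v] in \<open>meson less_imp_le order_trans\<close>)
qed

lemma pmf_bind_add_ge:
  assumes "0 \<le> c" "\<And>x. x \<in> set_pmf M \<Longrightarrow> x \<in> G \<Longrightarrow> c \<le> pmf (f x) i + pmf (f x) j"
  shows "c * measure_pmf.prob M G \<le> pmf (bind_pmf M f) i + pmf (bind_pmf M f) j"
proof -
  have "c * measure_pmf.prob M G = (\<integral>x. c * indicator G x \<partial>M)" by simp
  also have "\<dots> \<le> (\<integral>x. pmf (f x) i + pmf (f x) j \<partial>M)"
  proof (rule integral_mono_AE)
    show "integrable M (\<lambda>x. c * indicator G x)"
      by (rule measure_pmf.integrable_const_bound[where B = c]) (use assms(1) in \<open>auto simp: indicator_def\<close>)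
    show "AE x in M. c * indicator G x \<le> pmf (f x) i + pmf (f x) j"
      using assms(2) by (auto simp: AE_measure_pmf_iff indicator_def)
  qed (intro Bochner_Integration.integrable_add integrable_pmf_of)
  finally show ?thesis
    unfolding pmf_bind by (simp add: Bochner_Integration.integral_add integrable_pmf_of)
qed

text \<open>Averaged over the secrets, both inputs lead to the same law \<open>Q\<close> of stopped
  runs, so both verdicts would need large probability under \<open>Q\<close>. The default secret
  \<open>N\<close> is not below \<open>w\<close>, so an incomplete last block is never
  special.\<close>

lemma no_tester_if_hidden:
  fixes n w N :: nat and t :: real
  defines "D \<equiv> Pi_pmf {..<n div w} N (\<lambda>_. pmf_of_set {..<N})"
  assumes w: "0 < w" "w \<le> N" and t: "0 < t"
    and adv: "\<And>far \<sigma>. adv (hard_input w far \<sigma>) (hiding_adversary w t far cover \<sigma>)"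
    and budget: "36 * (real w * real w) \<le> t * real N"
    and far: "measure_pmf.prob D {\<sigma>. \<not> eps_far n \<epsilon> (sortedness n) (hard_input w True \<sigma>)} \<le> 1 / 12"
  shows "\<not> eps_tester n \<epsilon> (sortedness n) adv T"
proof
  assume T: "eps_tester n \<epsilon> (sortedness n) adv T"
  define U where "U = pmf_of_set {..<N}"
  have N: "0 < N" using w by simp
  have D: "resample U {..<n div w} (\<lambda>_. N) = D"
    unfolding resample_def D_def U_def by (intro Pi_pmf_default_swap) simp
  have finD: "finite (set_pmf D)"
    using N unfolding D_def by (subst set_Pi_pmf) (auto simp: lessThan_empty_iff)
  let ?adv = "\<lambda>far \<sigma>. hiding_adversary w t far cover \<sigma>"
  let ?far = "\<lambda>\<sigma>. eps_far n \<epsilon> (sortedness n) (hard_input w True \<sigma>)"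
  have "\<forall>\<^sub>F k in sequentially. 5 / 8 \<le> pmf (run T (?adv False \<sigma>) k []) (Some True)" for \<sigma>
  proof (rule eventually_verdict)
    have "2 / 3 \<le> verdict_prob T (?adv False \<sigma>) True"
      using T adv hard_input_sorted[OF w(1)] unfolding eps_tester_def by blast
    then show "5 / 8 < verdict_prob T (?adv False \<sigma>) True" by linarith
  qed
  moreover have "\<forall>\<^sub>F k in sequentially. 5 / 8 \<le> pmf (run T (?adv True \<sigma>) k []) (Some False)" if "?far \<sigma>" for \<sigma>
  proof (rule eventually_verdict)
    have "2 / 3 \<le> verdict_prob T (?adv True \<sigma>) False"
      using T adv that unfolding eps_tester_def by blast
    then show "5 / 8 < verdict_prob T (?adv True \<sigma>) False" by linarith
  qed
  ultimately have "\<forall>\<^sub>F k in sequentially. \<forall>\<sigma>\<in>set_pmf D. 5 / 8 \<le> pmf (run T (?adv False \<sigma>) k []) (Some True) \<and>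
      (?far \<sigma> \<longrightarrow> 5 / 8 \<le> pmf (run T (?adv True \<sigma>) k []) (Some False))"
    by (intro eventually_ball_finite finD ballI eventually_conj) (auto simp: eventually_const_iff)
  \<comment> \<open>One finite \<open>k\<close> serves all secrets because \<open>D\<close> has
    finite support; lowering 2/3 to 5/8 pays for replacing the supremum over
    \<open>k\<close>.\<close>
  then obtain k where k: "\<And>\<sigma>. \<sigma> \<in> set_pmf D \<Longrightarrow> 5 / 8 \<le> pmf (run T (?adv False \<sigma>) k []) (Some True)"
    "\<And>\<sigma>. \<sigma> \<in> set_pmf D \<Longrightarrow> ?far \<sigma> \<Longrightarrow> 5 / 8 \<le> pmf (run T (?adv True \<sigma>) k []) (Some False)"
    by (auto dest!: eventually_happens)
  let ?stop = "\<lambda>far \<sigma>. stopped_run T (ideal_oracle w far cover \<sigma>) (overspent w t \<sigma>) k []"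
  define Q where "Q = averaged_run w t False cover U T {..<n div w} (\<lambda>_. N) k []"
  have Q_False: "Q = bind_pmf D (?stop False)"
    unfolding Q_def averaged_run_def D ..
  have "Q = averaged_run w t True cover U T {..<n div w} (\<lambda>_. N) k []"
    unfolding Q_def by (rule averaged_run_far_eq[OF w U_def]) (use w in \<open>auto simp: queries_def\<close>)
  then have Q_True: "Q = bind_pmf D (?stop True)"
    unfolding averaged_run_def D .
  have stop: "pmf (run T (?adv far \<sigma>) k []) (Some v) \<le> pmf (?stop far \<sigma>) (Some (Some v)) + pmf (?stop far \<sigma>) None"
    for far \<sigma> v
    by (rule pmf_run_le_stopped_run) (rule hiding_adversary_eq_ideal)
  have "5 / 8 * measure_pmf.prob D UNIV \<le> pmf Q (Some (Some True)) + pmf Q None"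
    unfolding Q_False by (intro pmf_bind_add_ge order_trans[OF k(1) stop]) simp_all
  then have accept: "5 / 8 \<le> pmf Q (Some (Some True)) + pmf Q None" by simp
  have "5 / 8 * measure_pmf.prob D {\<sigma>. ?far \<sigma>} \<le> pmf Q (Some (Some False)) + pmf Q None"
    unfolding Q_True by (intro pmf_bind_add_ge order_trans[OF k(2) stop]) simp_all
  moreover have "11 / 12 \<le> measure_pmf.prob D {\<sigma>. ?far \<sigma>}"
    using far unfolding prob_Not by linarith
  ultimately have reject: "5 / 8 * (11 / 12) \<le> pmf Q (Some (Some False)) + pmf Q None"
    by linarith
  have "pmf Q (Some (Some True)) + pmf Q (Some (Some False)) + pmf Q None
    = measure_pmf.prob Q {Some (Some True), Some (Some False), None}"
    by (subst measure_measure_pmf_finite) auto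
  then have total: "pmf Q (Some (Some True)) + pmf Q (Some (Some False)) + pmf Q None \<le> 1"
    by simp
  \<comment> \<open>\<open>a\<close> is tuned so that a new block multiplies the mean of
    \<open>a ^ X\<close> by \<open>1 - w / N + t / w\<close>, which the decay
    \<open>exp (- (t / w))\<close> per query absorbs.\<close>
  define a where "a = t * real N / (real w * real w)"
  \<comment> \<open>An exponential supermartingale for the number \<open>X\<close> of touched special blocks after \<open>i\<close> queries.\<close>
  define Z where "Z X i = exp 1 / a * a ^ X * exp (- (t / real w * real i))" for X i :: nat
  have a: "36 \<le> a" using budget w by (simp add: a_def le_divide_eq)
  have e: "exp 1 \<le> (3::real)" by (rule exp_le)
  have "pmf Q None \<le> Z (card (touched w (\<lambda>_. N) (queries []))) (length (queries []))"
    unfolding Q_def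
  proof (rule prob_overspent_le[OF w U_def])
    show "0 \<le> Z X i" for X i using a by (simp add: Z_def)
    show "Z X (Suc i) \<le> Z X i" for X i
    proof -
      have "t / real w * real i \<le> t / real w * real (Suc i)" using t w by (intro mult_left_mono) auto
      then show ?thesis unfolding Z_def using a by (intro mult_left_mono) simp_all
    qed
    show "real (N - w) * Z X (Suc i) + real w * Z (Suc X) (Suc i) \<le> real N * Z X i" for X i
    proof -
      have wa: "real w * a = real N * (t / real w)" using w by (simp add: a_def field_simps)
      have "real (N - w) + real w * a \<le> real N * (1 + t / real w)"
        unfolding wa using w by (simp add: algebra_simps of_nat_diff)
      also have "\<dots> \<le> real N * exp (t / real w)"
        by (intro mult_left_mono) (auto simp: exp_ge_add_one_self)
      finally have "(real (N - w) + real w * a) * Z X (Suc i) \<le> (real N * exp (t / real w)) * Z X (Suc i)"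
        using a by (intro mult_right_mono) (auto simp: Z_def)
      also have "\<dots> = real N * Z X i"
        by (simp add: Z_def exp_add[symmetric] algebra_simps add_divide_distrib)
      also have "(real (N - w) + real w * a) * Z X (Suc i) = real (N - w) * Z X (Suc i) + real w * Z (Suc X) (Suc i)"
      proof -
        have "Z (Suc X) (Suc i) = a * Z X (Suc i)" unfolding Z_def power_Suc by (simp only: mult_ac)
        then show ?thesis by (simp only: distrib_right mult.assoc)
      qed
      finally show ?thesis .
    qed
    show "1 \<le> Z X i" if over: "real i * t < real (w * X)" for X i
    proof -
      have "0 \<le> real i * t" using t by simp
      \<comment> \<open>Overspending requires a touched block, so \<open>Z\<close> has to reach 1
        only for \<open>X \<ge> 1\<close>. This allows the division by \<open>a\<close>, which makes
        the initial value \<open>exp 1 / a\<close> small.\<close>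
      then obtain Y where Y: "X = Suc Y" using over by (cases X) auto
      have "t / real w * real i \<le> real X" using over w by (simp add: field_simps)
      have "1 \<le> (a / exp 1) ^ Y" using a e by (intro one_le_power) (simp add: le_divide_eq)
      also have "\<dots> = exp 1 / a * a ^ X * exp (- real X)"
        using a by (simp add: Y power_divide exp_of_nat_mult[symmetric] exp_minus exp_add exp_diff field_simps)
      also have "\<dots> \<le> Z X i"
        unfolding Z_def using a \<open>t / real w * real i \<le> real X\<close> by (intro mult_left_mono) auto
      finally show ?thesis .
    qed
  qed (use w in \<open>auto simp: queries_def\<close>)
  also have "\<dots> = exp 1 / a" by (simp add: Z_def touched_def queries_def)
  also have "\<dots> \<le> 3 / 36" using a e by (intro frac_le) auto
  \<comment> \<open>The event \<open>None\<close> counts in both bounds: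
    \<open>5/8 + 55/96 = 115/96\<close>, but the total is at most \<open>1 + 1/12\<close>.\<close>
  finally show False using accept reject total by linarith
qed

text \<open>For \<open>\<epsilon> \<le> 1 / 8\<close> a block is special with probability about
  \<open>8 * \<epsilon>\<close>, four times what farness needs when at least half of each special
  block must change. For larger \<open>\<epsilon>\<close> all complete blocks are special; then the
  lost fraction \<open>2 / w\<close> matters, and \<open>w \<ge> 4 / \<delta>\<close> makes it at
  most \<open>\<delta> / 2\<close>.\<close>

lemma no_sortedness_tester:
  fixes n w :: nat and t :: real
  assumes \<delta>: "0 < \<delta>" "\<delta> < 1" and w: "4 / \<delta> \<le> real w" and \<epsilon>: "0 < \<epsilon>" "\<epsilon> \<le> 1 - \<delta>"
    and C: "C = 40000 * (real w * real w)" and n: "C \<le> \<epsilon> * real n" and t: "C * \<epsilon> \<le> t"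
    and adv: "\<And>far \<sigma>. adv (hard_input w far \<sigma>) (hiding_adversary w t far cover \<sigma>)"
  shows "\<not> eps_tester n \<epsilon> (sortedness n) adv T"
proof -
  have "4 < 4 / \<delta>" using \<delta> by (simp add: less_divide_eq)
  then have w4: "4 < real w" using w by linarith
  have w0: "0 < w" using w4 by simp
  have ww: "real w \<le> real w * real w" using w4 by simp
  have C0: "40000 * real w \<le> C" "0 < C" using ww w4 by (auto simp: C)
  have t0: "0 < t" using C0 \<epsilon> t mult_pos_pos[of C \<epsilon>] by linarith
  let ?M = "n div w"
  have "n < (?M + 1) * w" using w0 dividend_less_div_times[of w n] by (simp add: algebra_simps)
  then have "real n < real ((?M + 1) * w)" by (simp only: of_nat_less_iff)
  then have M_ge: "real n - real w \<le> real ?M * real w" by (simp add: algebra_simps)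
  have "?M * w \<le> n" by simp
  then have "real (?M * w) \<le> real n" by (simp only: of_nat_le_iff)
  then have M_le: "real ?M * real w \<le> real n" by simp
  have n_ge: "C \<le> real n"
  proof -
    have "\<epsilon> * real n \<le> 1 * real n" using \<epsilon> \<delta> by (intro mult_right_mono) auto
    then show ?thesis using n by simp
  qed
  have w2: "real (w - 2) = real w - 2" using w4 by (simp add: of_nat_diff)
  have combine: "x - y \<le> - 3" if "2 * x - 4 * \<epsilon> \<le> y" "10 \<le> x" "\<epsilon> \<le> 1 / 8" for x y :: real
    using that by linarith
  show ?thesis
  proof (cases "\<epsilon> \<le> 1 / 8")
    case True
    define N where "N = nat \<lfloor>real w / (8 * \<epsilon>)\<rfloor>"
    have w_le: "real w \<le> real w / (8 * \<epsilon>)" using True \<epsilon> w0 by (simp add: le_divide_eq)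
    then have wN: "w \<le> N" unfolding N_def by (simp add: le_nat_iff le_floor_iff)
    have "real N = of_int \<lfloor>real w / (8 * \<epsilon>)\<rfloor>"
      unfolding N_def using w_le w4 by (intro of_nat_nat) (simp add: le_floor_iff)
    then have N: "real N \<le> real w / (8 * \<epsilon>)" "real w / (8 * \<epsilon>) - 1 \<le> real N" by linarith+
    have N0: "0 < real N" using wN w0 by simp
    have N_ge: "real w / (16 * \<epsilon>) \<le> real N"
    proof -
      have "real w / (8 * \<epsilon>) = 2 * (real w / (16 * \<epsilon>))" by simp
      then show ?thesis using N(2) w_le w4 by linarith
    qed
    \<comment> \<open>As \<open>w - 2 \<ge> w / 2\<close>, \<open>m\<close> special blocks make the
      input far. The expected number is about \<open>4 * m\<close> or more, which leaves about
      \<open>2 * m\<close> to subtract in the exponent of the tail bound.\<close>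
    define m where "m = 2 * \<epsilon> * real n / real w"
    let ?D = "Pi_pmf {..<?M} N (\<lambda>_. pmf_of_set {..<N})"
    have "measure_pmf.prob ?D {\<sigma>. \<not> eps_far n \<epsilon> (sortedness n) (hard_input w True \<sigma>)}
      \<le> measure_pmf.prob ?D {\<sigma>. real (card {j. j < ?M \<and> \<sigma> j < w}) < m}"
    proof (intro measure_pmf.finite_measure_mono subsetI CollectI)
      fix \<sigma> assume "\<sigma> \<in> {\<sigma>. \<not> eps_far n \<epsilon> (sortedness n) (hard_input w True \<sigma>)}"
      then have "real ((w - 2) * card {j. j < ?M \<and> \<sigma> j < w}) < \<epsilon> * real n" (is "real (_ * ?c) < _")
        using hard_input_far[of w \<epsilon> n \<sigma>] w4 by force
      moreover have "real w / 2 * real ?c \<le> (real w - 2) * real ?c"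
        using w4 by (intro mult_right_mono) auto
      ultimately have "real w / 2 * real ?c < \<epsilon> * real n" by (simp add: w2)
      then show "real ?c < m" using w4 by (simp add: m_def field_simps)
    qed simp
    also have "\<dots> \<le> exp (m - real ?M * real w / (2 * real N))"
      by (rule prob_few_special_le[OF w0 wN])
    also have "\<dots> \<le> exp (- 3)"
    proof -
      have "1 / (2 * real N) \<ge> 4 * \<epsilon> / real w"
        using N(1) N0 \<epsilon> w0 by (simp add: field_simps)
      then have "(real n - real w) * (4 * \<epsilon> / real w) \<le> real ?M * real w * (1 / (2 * real N))"
        using M_ge N0 \<epsilon> w0 by (intro mult_mono) auto
      moreover have "(real n - real w) * (4 * \<epsilon> / real w) = 2 * m - 4 * \<epsilon>"
        using w0 by (simp add: m_def field_simps)
      moreover have "real w * 10 \<le> 2 * \<epsilon> * real n" using n C0(1) w4 by linarith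
      then have "10 \<le> m" using w0 by (simp add: m_def le_divide_eq)
      moreover have "real ?M * real w * (1 / (2 * real N)) = real ?M * real w / (2 * real N)" by simp
      ultimately have "2 * m - 4 * \<epsilon> \<le> real ?M * real w / (2 * real N)" "10 \<le> m" by metis+
      then have "m - real ?M * real w / (2 * real N) \<le> - 3"
        using True by (intro combine)
      then show ?thesis by simp
    qed
    also have "\<dots> \<le> 1 / 12" by (rule exp_minus_3_le)
    finally have "measure_pmf.prob ?D {\<sigma>. \<not> eps_far n \<epsilon> (sortedness n) (hard_input w True \<sigma>)} \<le> 1 / 12" .
    moreover have "36 * (real w * real w) \<le> t * real N"
    proof -
      have "36 * (real w * real w) * 1 \<le> 2500 * (real w * real w) * real w"
        using w4 by (intro mult_mono) auto
      then have "36 * (real w * real w) \<le> 2500 * (real w * real w) * real w" by simp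
      also have "\<dots> = C * \<epsilon> * (real w / (16 * \<epsilon>))" using \<epsilon> by (simp add: C)
      also have "\<dots> \<le> t * real N"
        using t N_ge t0 \<epsilon> by (intro mult_mono) auto
      finally show ?thesis .
    qed
    ultimately show ?thesis
      by (intro no_tester_if_hidden[where adv = adv and cover = cover, OF w0 wN t0 adv]) auto
  next
    case False
    let ?D = "Pi_pmf {..<?M} w (\<lambda>_. pmf_of_set {..<w})"
    have "eps_far n \<epsilon> (sortedness n) (hard_input w True \<sigma>)" if "\<sigma> \<in> set_pmf ?D" for \<sigma>
    proof (rule hard_input_far)
      have "\<sigma> j < w" if "j < ?M" for j
        using \<open>\<sigma> \<in> _\<close> that w0 by (auto simp: set_Pi_pmf PiE_dflt_def lessThan_empty_iff)
      then have "{j. j < ?M \<and> \<sigma> j < w} = {..<?M}" by auto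
      moreover have "\<epsilon> * real n \<le> real (w - 2) * real ?M"
      proof -
        have "2 * real ?M \<le> \<delta> / 2 * real n"
        proof -
          have "4 \<le> \<delta> * real w" using w \<delta> by (simp add: divide_le_eq mult.commute)
          then have "4 * real ?M \<le> \<delta> * real w * real ?M" by (intro mult_right_mono) auto
          also have "\<dots> \<le> \<delta> * real n" using M_le \<delta> by (simp add: mult.assoc mult.commute)
          finally show ?thesis by simp
        qed
        moreover have "real w \<le> \<delta> / 2 * real n"
        proof -
          have "4 \<le> \<delta> * real w" using w \<delta> by (simp add: divide_le_eq mult.commute)
          then have "4 * (10000 * real w) \<le> \<delta> * real w * (10000 * real w)" using w4 by (intro mult_right_mono) auto
          also have "\<dots> = \<delta> * C / 4" by (simp add: C)
          also have "\<dots> \<le> \<delta> * real n / 4" using n_ge \<delta> by simp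
          finally show ?thesis using w4 \<delta> by simp
        qed
        moreover have "real (w - 2) * real ?M = real ?M * real w - 2 * real ?M"
          by (simp add: w2 algebra_simps)
        moreover have "\<epsilon> * real n \<le> (1 - \<delta>) * real n" using \<epsilon> by (intro mult_right_mono) auto
        then have "\<epsilon> * real n \<le> real n - \<delta> * real n" by (simp add: algebra_simps)
        ultimately show ?thesis using M_ge by simp
      qed
      ultimately show "\<epsilon> * real n \<le> real ((w - 2) * card {j. j < ?M \<and> \<sigma> j < w})" by simp
    qed (use w4 in simp)
    then have "measure_pmf.prob ?D {\<sigma>. \<not> eps_far n \<epsilon> (sortedness n) (hard_input w True \<sigma>)} = 0"
      by (subst measure_pmf_zero_iff) auto
    moreover have "36 * (real w * real w) \<le> t * real w"
    proof -
      have "36 * real w \<le> C * (1 / 8)" using C0 w4 by simp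
      also have "\<dots> \<le> C * \<epsilon>" using False C0 by (intro mult_left_mono) auto
      finally have "36 * real w \<le> t" using t by linarith
      then have "36 * real w * real w \<le> t * real w" by (intro mult_right_mono) auto
      then show ?thesis by simp
    qed
    ultimately show ?thesis
      by (intro no_tester_if_hidden[where adv = adv and cover = cover, OF w0 order_refl t0 adv]) auto
  qed
qed

text \<open>\<open>C\<close> depends on \<open>\<delta>\<close> because the lower bound fails for
  \<open>\<epsilon>\<close> too close to 1: changing \<open>n - 1\<close> values makes any sequence
  constant, so nothing is far once \<open>\<epsilon> * n > n - 1\<close>, and accepting always is
  then correct. \<open>c\<close> and \<open>K\<close> are absolute.\<close>

theorem theorem1p4:
  shows "\<exists>c K :: real. 0 < c \<and> 0 < K \<and> (\<forall>\<delta> :: real. 0 < \<delta> \<and> \<delta> < 1 \<longrightarrow>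
    (\<exists>C :: real. c < C \<and>
      (\<forall>(\<epsilon> :: real) (n :: nat). 0 < \<epsilon> \<and> \<epsilon> < 1 \<and> real n \<ge> C / \<epsilon> \<longrightarrow>
        (\<forall>P t. local_property n P \<and> 0 < t \<and> t \<le> c * \<epsilon> \<longrightarrow>
          (\<exists>T q. real q \<le> K * (log 2 (\<epsilon> * real n) / \<epsilon>) \<and> makes_at_most_queries q T \<and>
             eps_tester n \<epsilon> P (erasure_adversary n t) T \<and>
             one_sided P (erasure_adversary n t) T) \<and>
          (\<exists>T q. real q \<le> K * (log 2 (\<epsilon> * real n) / \<epsilon>) \<and> makes_at_most_queries q T \<and>
             eps_tester n \<epsilon> P (corruption_adversary n t) T)) \<and>
        (\<epsilon> \<le> 1 - \<delta> \<longrightarrow> (\<forall>t \<ge> C * \<epsilon>.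
          \<not> (\<exists>T. eps_tester n \<epsilon> (sortedness n) (erasure_adversary n t) T) \<and>
          \<not> (\<exists>T. eps_tester n \<epsilon> (sortedness n) (corruption_adversary n t) T))))))"
proof (rule exI[of _ "1 / 2400"], rule exI[of _ 194], intro conjI allI impI)
  fix \<delta> :: real assume \<delta>: "0 < \<delta> \<and> \<delta> < 1"
  define w where "w = nat \<lceil>4 / \<delta>\<rceil>"
  define C where "C = 40000 * (real w * real w)"
  have w: "4 / \<delta> \<le> real w" unfolding w_def by (rule real_nat_ceiling_ge)
  moreover have "4 < 4 / \<delta>" using \<delta> by (simp add: less_divide_eq)
  ultimately have w1: "1 \<le> real w" by linarith
  then have "1 \<le> real w * real w" using mult_mono[of 1 "real w" 1 "real w"] by simp
  then have C1: "40000 \<le> C" by (simp add: C_def)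
  have w0: "0 < w" using w1 by simp
  show "\<exists>C :: real. 1 / 2400 < C \<and>
      (\<forall>(\<epsilon> :: real) (n :: nat). 0 < \<epsilon> \<and> \<epsilon> < 1 \<and> real n \<ge> C / \<epsilon> \<longrightarrow>
        (\<forall>P t. local_property n P \<and> 0 < t \<and> t \<le> 1 / 2400 * \<epsilon> \<longrightarrow>
          (\<exists>T q. real q \<le> 194 * (log 2 (\<epsilon> * real n) / \<epsilon>) \<and> makes_at_most_queries q T \<and>
             eps_tester n \<epsilon> P (erasure_adversary n t) T \<and>
             one_sided P (erasure_adversary n t) T) \<and>
          (\<exists>T q. real q \<le> 194 * (log 2 (\<epsilon> * real n) / \<epsilon>) \<and> makes_at_most_queries q T \<and>
             eps_tester n \<epsilon> P (corruption_adversary n t) T)) \<and>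
        (\<epsilon> \<le> 1 - \<delta> \<longrightarrow> (\<forall>t \<ge> C * \<epsilon>.
          \<not> (\<exists>T. eps_tester n \<epsilon> (sortedness n) (erasure_adversary n t) T) \<and>
          \<not> (\<exists>T. eps_tester n \<epsilon> (sortedness n) (corruption_adversary n t) T))))"
  proof (intro exI[of _ C] conjI allI impI)
    fix \<epsilon> :: real and n :: nat and P :: "(nat \<Rightarrow> real) set" and t :: real
    assume "0 < \<epsilon> \<and> \<epsilon> < 1 \<and> C / \<epsilon> \<le> real n" and Pt: "local_property n P \<and> 0 < t \<and> t \<le> 1 / 2400 * \<epsilon>"
    then have \<epsilon>: "0 < \<epsilon>" "\<epsilon> < 1" and n: "C \<le> \<epsilon> * real n" by (auto simp: divide_le_eq mult.commute)
    have "2 ^ 15 \<le> \<epsilon> * real n" using n C1 by simp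
    from local_property_tester[OF _ \<epsilon> this, of P t] Pt
    obtain T q where "real q \<le> 194 * (log 2 (\<epsilon> * real n) / \<epsilon>)" "makes_at_most_queries q T"
      "eps_tester n \<epsilon> P (erasure_adversary n t) T" "one_sided P (erasure_adversary n t) T"
      "eps_tester n \<epsilon> P (corruption_adversary n t) T"
      by auto
    then show "\<exists>T q. real q \<le> 194 * (log 2 (\<epsilon> * real n) / \<epsilon>) \<and> makes_at_most_queries q T \<and>
             eps_tester n \<epsilon> P (erasure_adversary n t) T \<and> one_sided P (erasure_adversary n t) T"
      and "\<exists>T q. real q \<le> 194 * (log 2 (\<epsilon> * real n) / \<epsilon>) \<and> makes_at_most_queries q T \<and>
             eps_tester n \<epsilon> P (corruption_adversary n t) T"
      by blast+
  next
    fix \<epsilon> :: real and n :: nat and t :: real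
    assume "0 < \<epsilon> \<and> \<epsilon> < 1 \<and> C / \<epsilon> \<le> real n" and \<epsilon>1: "\<epsilon> \<le> 1 - \<delta>" and t: "C * \<epsilon> \<le> t"
    then have \<epsilon>: "0 < \<epsilon>" and n: "C \<le> \<epsilon> * real n" by (auto simp: divide_le_eq mult.commute)
    have t0: "0 < t" using t C1 \<epsilon> mult_pos_pos[of C \<epsilon>] by linarith
    note no = no_sortedness_tester[OF conjunct1[OF \<delta>] conjunct2[OF \<delta>] w \<epsilon> \<epsilon>1 C_def n t]
    show "\<not> (\<exists>T. eps_tester n \<epsilon> (sortedness n) (erasure_adversary n t) T)"
      using no[where adv = "erasure_adversary n t" and cover = "\<lambda>_. None"]
        erasure_adversary_hiding[OF w0 t0] by blast
    show "\<not> (\<exists>T. eps_tester n \<epsilon> (sortedness n) (corruption_adversary n t) T)"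
      using no[where adv = "corruption_adversary n t" and cover = Some]
        corruption_adversary_hiding[OF w0 t0] by blast
  qed (use C1 in simp)
qed simp_all

end
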